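(* Let $X$ be the complexification of a real Banach space. (a) Let $T$ be a real bounded linear operator on $X$ with $\sigma(T)\subset \mathbb{C}\setminus(-\infty,0]$. Then $T$ is embeddable into a real group with bounded generator, i.e., there exists a strongly continuous group $(T(t))_{t\in\mathbb{R}}$ on $X$ with bounded generator such that $T(t)$ is real for every $t\in\mathbb{R}$ and $T(1)=T$. (b) Let $T$ be a real sectorial bounded linear operator on $X$ with dense range. Then $T$ is real-embeddable.
   Context: Let $Y$ be a real Banach space and $X=Y+iY$ its complexification with norm $\|y_1+iy_2\|:=\sup_{t\in[0,2\pi]}\|\cos t\cdot y_1-\sin t\cdot y_2\|$. A bounded linear operator $T$ on $X$ is called real if $TY\subset Y$. A $C_0$-semigroup $(T(t))_{t\ge 0}$ or group $(T(t))_{t\in\mathbb{R}}$ is real if every $T(t)$ is real. A real operator $T$ is real-embeddable if there exists a real strongly continuous semigroup $(T(t))_{t\ge0}$ on $X$ with $T(1)=T$. $\sigma(T)$ denotes the spectrum and $R(\lambda,T)=(\lambda-T)^{-1}$ the resolvent. An operator $T$ is called sectorial if there exists $\delta\in(0,\pi)$ such that, with $\Sigma_\delta:=\{z\in\mathbb{C}: |\arg z|\le\delta\}\cup\{0\}$, one has $\sigma(T)\subset\Sigma_\delta$ and $\sup_{\lambda\notin\Sigma_\delta}\|\lambda R(\lambda,T)\|<\infty$. (Equivalently: $(-\infty,0)\subset\rho(T)$ and $\sup_{s<0}\|sR(s,T)\|<\infty$.) *)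

theory Defs
  imports "HOL-Analysis.Analysis"
begin

section \<open>The complexification of a real Banach space\<close>

text \<open>\<open>Cx y\<^sub>1 y\<^sub>2\<close> stands for \<open>y\<^sub>1 + i y\<^sub>2\<close>. A separate type is used instead of the product
  type because the library equips products with a different norm.\<close>

datatype 'a complexification = Cx (re_part: 'a) (im_part: 'a)

instantiation complexification :: (real_vector) real_vector
begin

definition "0 = Cx 0 0"
definition "x + y = Cx (re_part x + re_part y) (im_part x + im_part y)"
definition "- x = Cx (- re_part x) (- im_part x)"
definition "x - y = Cx (re_part x - re_part y) (im_part x - im_part y)"
definition "a *\<^sub>R x = Cx (a *\<^sub>R re_part x) (a *\<^sub>R im_part x)"

instance
  by standard
    (auto simp: zero_complexification_def plus_complexification_def uminus_complexification_def
      minus_complexification_def scaleR_complexification_def scaleR_add_left scaleR_add_right)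

end

lemma part_simps [simp]:
  "re_part 0 = 0" "im_part 0 = 0"
  "re_part (x + y) = re_part x + re_part y" "im_part (x + y) = im_part x + im_part y"
  "re_part (- x) = - re_part x" "im_part (- x) = - im_part x"
  "re_part (x - y) = re_part x - re_part y" "im_part (x - y) = im_part x - im_part y"
  "re_part (a *\<^sub>R x) = a *\<^sub>R re_part x" "im_part (a *\<^sub>R x) = a *\<^sub>R im_part x"
  by (simp_all add: zero_complexification_def plus_complexification_def
      uminus_complexification_def minus_complexification_def scaleR_complexification_def)

lemma complexification_eqI:
  "re_part x = re_part y \<Longrightarrow> im_part x = im_part y \<Longrightarrow> x = y"
  by (rule complexification.expand) simp

definition scaleC :: "complex \<Rightarrow> 'a::real_vector complexification \<Rightarrow> 'a complexification"
    (infixr "*\<^sub>C" 75)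
  where "c *\<^sub>C x = Cx (Re c *\<^sub>R re_part x - Im c *\<^sub>R im_part x)
                       (Re c *\<^sub>R im_part x + Im c *\<^sub>R re_part x)"

lemma scaleC_parts [simp]:
  "re_part (c *\<^sub>C x) = Re c *\<^sub>R re_part x - Im c *\<^sub>R im_part x"
  "im_part (c *\<^sub>C x) = Re c *\<^sub>R im_part x + Im c *\<^sub>R re_part x"
  by (simp_all add: scaleC_def)

lemma scaleC_module:
  "c *\<^sub>C (x + y) = c *\<^sub>C x + c *\<^sub>C y"
  "(c + d) *\<^sub>C x = c *\<^sub>C x + d *\<^sub>C x"
  "c *\<^sub>C (d *\<^sub>C x) = (c * d) *\<^sub>C x"
  "1 *\<^sub>C x = x"
  "complex_of_real r *\<^sub>C x = r *\<^sub>R x"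
  by (auto intro!: complexification_eqI simp: algebra_simps)

instantiation complexification :: (real_normed_vector) real_normed_vector
begin

definition norm_complexification :: "'a complexification \<Rightarrow> real" where
  "norm_complexification x =
     (SUP t\<in>{0..2*pi}. norm (cos t *\<^sub>R re_part x - sin t *\<^sub>R im_part x))"

definition dist_complexification :: "'a complexification \<Rightarrow> 'a complexification \<Rightarrow> real" where
  "dist_complexification x y = norm (x - y)"

definition sgn_complexification :: "'a complexification \<Rightarrow> 'a complexification" where
  "sgn_complexification x = x /\<^sub>R norm x"

definition uniformity_complexification ::
    "('a complexification \<times> 'a complexification) filter" where
  "uniformity_complexification = (INF e\<in>{0 <..}. principal {(x, y). dist x y < e})"

definition open_complexification :: "'a complexification set \<Rightarrow> bool" where
  "open_complexification U \<longleftrightarrow>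
     (\<forall>x\<in>U. eventually (\<lambda>(x', y). x' = x \<longrightarrow> y \<in> U) uniformity)"

lemma rotation_le_parts:
  fixes x :: "'a complexification"
  shows "norm (cos t *\<^sub>R re_part x - sin t *\<^sub>R im_part x) \<le> norm (re_part x) + norm (im_part x)"
proof -
  have "norm (cos t *\<^sub>R re_part x - sin t *\<^sub>R im_part x)
      \<le> \<bar>cos t\<bar> * norm (re_part x) + \<bar>sin t\<bar> * norm (im_part x)"
    by (rule order_trans [OF norm_triangle_ineq4]) simp
  also have "\<dots> \<le> 1 * norm (re_part x) + 1 * norm (im_part x)"
    by (intro add_mono mult_right_mono) (auto simp: abs_cos_le_one abs_sin_le_one)
  finally show ?thesis by simp
qed

lemma rotation_le_norm:
  fixes x :: "'a complexification"
  shows "norm (cos t *\<^sub>R re_part x - sin t *\<^sub>R im_part x) \<le> norm x"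
proof -
  obtain s where s: "0 \<le> s" "s < 2 * pi" "cos t = cos s" "sin t = sin s"
    using sincos_total_2pi [of "cos t" "sin t"] by (auto simp: power2_eq_square[symmetric])
  show ?thesis
    unfolding norm_complexification_def s(3,4)
    by (rule cSUP_upper)
      (use s in \<open>auto intro!: bdd_aboveI2 [where M = "norm (re_part x) + norm (im_part x)"]
         rotation_le_parts\<close>)
qed

lemma norm_complexification_least:
  fixes x :: "'a complexification"
  assumes "\<And>t. norm (cos t *\<^sub>R re_part x - sin t *\<^sub>R im_part x) \<le> K"
  shows "norm x \<le> K"
  unfolding norm_complexification_def by (rule cSUP_least) (use assms in auto)

lemma norm_complexification_parts:
  fixes x :: "'a complexification"
  shows "norm (re_part x) \<le> norm x" "norm (im_part x) \<le> norm x"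
    "norm x \<le> norm (re_part x) + norm (im_part x)"
  using rotation_le_norm [of 0 x] rotation_le_norm [of "pi/2" x]
  by (auto intro: norm_complexification_least rotation_le_parts)

instance
proof
  fix x y :: "'a complexification" and a :: real
  show "norm x = 0 \<longleftrightarrow> x = 0"
  proof
    assume "norm x = 0"
    with norm_complexification_parts(1,2) [of x] show "x = 0"
      by (intro complexification_eqI) auto
  next
    assume "x = 0"
    with norm_complexification_parts(3) [of x] norm_complexification_parts(1) [of x]
    show "norm x = 0" by simp
  qed
  show "norm (x + y) \<le> norm x + norm y"
  proof (rule norm_complexification_least)
    fix t
    have "cos t *\<^sub>R re_part (x + y) - sin t *\<^sub>R im_part (x + y)
        = (cos t *\<^sub>R re_part x - sin t *\<^sub>R im_part x) + (cos t *\<^sub>R re_part y - sin t *\<^sub>R im_part y)"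
      by (simp add: algebra_simps)
    then show "norm (cos t *\<^sub>R re_part (x + y) - sin t *\<^sub>R im_part (x + y)) \<le> norm x + norm y"
      by (simp only:) (rule order_trans [OF norm_triangle_ineq add_mono [OF rotation_le_norm rotation_le_norm]])
  qed
  have le: "norm (b *\<^sub>R z) \<le> \<bar>b\<bar> * norm z" for b and z :: "'a complexification"
  proof (rule norm_complexification_least)
    fix t
    have "cos t *\<^sub>R re_part (b *\<^sub>R z) - sin t *\<^sub>R im_part (b *\<^sub>R z)
        = b *\<^sub>R (cos t *\<^sub>R re_part z - sin t *\<^sub>R im_part z)"
      by (simp add: algebra_simps)
    then show "norm (cos t *\<^sub>R re_part (b *\<^sub>R z) - sin t *\<^sub>R im_part (b *\<^sub>R z)) \<le> \<bar>b\<bar> * norm z"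
      by (simp add: mult_left_mono rotation_le_norm)
  qed
  show "norm (a *\<^sub>R x) = \<bar>a\<bar> * norm x"
  proof (cases "a = 0")
    case True
    with le [of 0 x] norm_complexification_parts(1) [of "0 *\<^sub>R x"] show ?thesis
      by simp
  next
    case False
    then have "norm x \<le> \<bar>inverse a\<bar> * norm (a *\<^sub>R x)"
      using le [of "inverse a" "a *\<^sub>R x"] by simp
    then have "\<bar>a\<bar> * norm x \<le> \<bar>a\<bar> * (\<bar>inverse a\<bar> * norm (a *\<^sub>R x))"
      by (rule mult_left_mono) simp
    also have "\<dots> = norm (a *\<^sub>R x)"
      using False by (simp add: abs_mult [symmetric] flip: mult.assoc)
    finally show ?thesis
      using le [of a x] by linarith
  qed
qed (rule dist_complexification_def sgn_complexification_def uniformity_complexification_def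
      open_complexification_def)+

end

instance complexification :: (banach) banach
proof
  fix X :: "nat \<Rightarrow> 'a complexification"
  assume X: "Cauchy X"
  have "Cauchy (\<lambda>n. re_part (X n))" "Cauchy (\<lambda>n. im_part (X n))"
    using X unfolding Cauchy_iff part_simps(7,8) [symmetric]
    by (meson norm_complexification_parts(1,2) order_le_less_trans)+
  then obtain a b where ab: "(\<lambda>n. re_part (X n)) \<longlonglongrightarrow> a" "(\<lambda>n. im_part (X n)) \<longlonglongrightarrow> b"
    by (meson Cauchy_convergent_iff convergent_def)
  have "(\<lambda>n. norm (re_part (X n) - a) + norm (im_part (X n) - b)) \<longlonglongrightarrow> 0"
    using ab by (auto intro!: tendsto_add_zero simp: tendsto_norm_zero_iff LIM_zero_iff)
  then have "(\<lambda>n. X n - Cx a b) \<longlonglongrightarrow> 0"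
    by (rule Lim_null_comparison [rotated])
      (auto intro!: always_eventually order_trans [OF norm_complexification_parts(3)])
  then show "convergent X"
    using LIM_zero_cancel convergent_def by blast
qed

lemma norm_scaleC: "norm (c *\<^sub>C x) = cmod c * norm x"
  for x :: "'a::real_normed_vector complexification"
proof -
  have rot: "norm (cis s *\<^sub>C z) \<le> norm z" for s and z :: "'a complexification"
  proof (rule norm_complexification_least)
    fix t
    have "cos t *\<^sub>R re_part (cis s *\<^sub>C z) - sin t *\<^sub>R im_part (cis s *\<^sub>C z)
        = cos (t + s) *\<^sub>R re_part z - sin (t + s) *\<^sub>R im_part z"
      by (simp add: cos_add sin_add algebra_simps)
    then show "norm (cos t *\<^sub>R re_part (cis s *\<^sub>C z) - sin t *\<^sub>R im_part (cis s *\<^sub>C z)) \<le> norm z"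
      by (simp only: rotation_le_norm)
  qed
  have "norm z \<le> norm (cis s *\<^sub>C z)" for s and z :: "'a complexification"
    using rot [of "- s" "cis s *\<^sub>C z"] by (simp add: scaleC_module cis_mult)
  then have eq: "norm (cis s *\<^sub>C z) = norm z" for s and z :: "'a complexification"
    using rot by (rule order.antisym [rotated])
  have "c *\<^sub>C x = cmod c *\<^sub>R (cis (Arg c) *\<^sub>C x)"
    by (metis rcis_cmod_Arg rcis_def scaleC_module(3,5))
  then show ?thesis
    by (simp add: eq)
qed


section \<open>Bounded operators, spectrum and sectoriality\<close>

text \<open>The library type \<open>\<Rightarrow>\<^sub>L\<close> consists of the bounded real-linear maps, so complex linearity is
  a separate predicate.\<close>

type_synonym 'a oper = "'a complexification \<Rightarrow>\<^sub>L 'a complexification"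

definition complex_linear :: "'a::real_normed_vector oper \<Rightarrow> bool" where
  "complex_linear T \<longleftrightarrow> (\<forall>c x. blinfun_apply T (c *\<^sub>C x) = c *\<^sub>C blinfun_apply T x)"

definition real_subspace :: "'a::real_normed_vector complexification set" where
  "real_subspace = range (\<lambda>y. Cx y 0)"

definition real_operator :: "'a::real_normed_vector oper \<Rightarrow> bool" where
  "real_operator T \<longleftrightarrow> blinfun_apply T ` real_subspace \<subseteq> real_subspace"

lift_definition scalar_op :: "complex \<Rightarrow> 'a::real_normed_vector oper" is "\<lambda>c x. c *\<^sub>C x"
proof -
  fix c :: complex
  show "bounded_linear (\<lambda>x::'a complexification. c *\<^sub>C x)"
    by (rule bounded_linear_intro [where K = "cmod c"])
      (auto intro!: complexification_eqI simp: norm_scaleC algebra_simps)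
qed

definition inverse_op :: "'a::real_normed_vector oper \<Rightarrow> 'a oper \<Rightarrow> bool" where
  "inverse_op T S \<longleftrightarrow>
     complex_linear S \<and> S o\<^sub>L T = id_blinfun \<and> T o\<^sub>L S = id_blinfun"

definition spectrum :: "'a::real_normed_vector oper \<Rightarrow> complex set" where
  "spectrum T = {l. \<not> (\<exists>S. inverse_op (scalar_op l - T) S)}"

text \<open>Meaningful only for \<open>l\<close> outside \<open>spectrum T\<close>.\<close>
definition resolvent :: "complex \<Rightarrow> 'a::real_normed_vector oper \<Rightarrow> 'a oper" where
  "resolvent l T = (THE S. inverse_op (scalar_op l - T) S)"

lemma resolvent_eqI:
  assumes "inverse_op (scalar_op l - T) S"
  shows "resolvent l T = S"
  unfolding resolvent_def
proof (rule the_equality)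
  show "inverse_op (scalar_op l - T) S" by (rule assms)
next
  let ?A = "scalar_op l - T"
  fix S' assume S': "inverse_op ?A S'"
  have "S' = S' o\<^sub>L (?A o\<^sub>L S)"
    using assms by (auto simp: inverse_op_def intro: blinfun_eqI)
  also have "\<dots> = (S' o\<^sub>L ?A) o\<^sub>L S"
    by (rule blinfun_eqI) simp
  also have "\<dots> = S"
    using S' by (auto simp: inverse_op_def intro: blinfun_eqI)
  finally show "S' = S" .
qed

definition sector :: "real \<Rightarrow> complex set" where
  "sector \<delta> = {z. \<bar>Arg z\<bar> \<le> \<delta>} \<union> {0}"

definition sectorial :: "'a::real_normed_vector oper \<Rightarrow> bool" where
  "sectorial T \<longleftrightarrow>
     (\<exists>\<delta>\<in>{0<..<pi}. spectrum T \<subseteq> sector \<delta> \<and>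
        bdd_above ((\<lambda>l. norm (scalar_op l o\<^sub>L resolvent l T)) ` (- sector \<delta>)))"


section \<open>Strongly continuous semigroups and groups\<close>

text \<open>Only the values \<open>S t\<close> with \<open>t \<ge> 0\<close> are relevant.\<close>
definition C0_semigroup :: "(real \<Rightarrow> 'a::real_normed_vector oper) \<Rightarrow> bool" where
  "C0_semigroup S \<longleftrightarrow>
     (\<forall>t\<ge>0. complex_linear (S t)) \<and>
     S 0 = id_blinfun \<and>
     (\<forall>s\<ge>0. \<forall>t\<ge>0. S (s + t) = S s o\<^sub>L S t) \<and>
     (\<forall>x. continuous_on {0..} (\<lambda>t. blinfun_apply (S t) x))"

definition C0_group :: "(real \<Rightarrow> 'a::real_normed_vector oper) \<Rightarrow> bool" where
  "C0_group S \<longleftrightarrow>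
     (\<forall>t. complex_linear (S t)) \<and>
     S 0 = id_blinfun \<and>
     (\<forall>s t. S (s + t) = S s o\<^sub>L S t) \<and>
     (\<forall>x. continuous_on UNIV (\<lambda>t. blinfun_apply (S t) x))"

definition diff_quot ::
    "(real \<Rightarrow> 'a::real_normed_vector oper) \<Rightarrow> 'a complexification \<Rightarrow> real \<Rightarrow> 'a complexification" where
  "diff_quot S x h = (blinfun_apply (S h) x - x) /\<^sub>R h"

definition group_generator_domain ::
    "(real \<Rightarrow> 'a::real_normed_vector oper) \<Rightarrow> 'a complexification set" where
  "group_generator_domain S = {x. \<exists>y. (diff_quot S x \<longlongrightarrow> y) (at 0)}"

definition group_generator ::
    "(real \<Rightarrow> 'a::real_normed_vector oper) \<Rightarrow> 'a complexification \<Rightarrow> 'a complexification" where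
  "group_generator S x = Lim (at 0) (diff_quot S x)"

definition bounded_group_generator :: "(real \<Rightarrow> 'a::real_normed_vector oper) \<Rightarrow> bool" where
  "bounded_group_generator S \<longleftrightarrow>
     group_generator_domain S = UNIV \<and> bounded_linear (group_generator S)"

definition real_embeddable :: "'a::real_normed_vector oper \<Rightarrow> bool" where
  "real_embeddable T \<longleftrightarrow>
     real_operator T \<and>
     (\<exists>S. C0_semigroup S \<and> (\<forall>t\<ge>0. real_operator (S t)) \<and> S 1 = T)"

end

theory Submission
  imports Defs
begin

text \<open>
A complex-linear real operator on the complexification is determined by its restriction \<open>T\<close> to the
real Banach space \<open>Y\<close>. Both spectral hypotheses concern the negative real axis, where the resolvent
acts on \<open>Y\<close> (\<open>complexify_real_inverse\<close>): in the first part \<open>s + T\<close> is invertible on \<open>Y\<close> for all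
\<open>s \<ge> 0\<close>; in the second part it is so for all \<open>s > 0\<close>, with inverse bounded by \<open>M / s\<close>. The group or
semigroup is built on \<open>Y\<close> from these real resolvents and complexified at the end, so it is
automatically real.

For the first part the segment \<open>(1 - u) + u T\<close>, with \<open>u\<close> from \<open>0\<close> to \<open>1\<close>, consists of commuting
invertible operators. Integrating its logarithmic derivative \<open>(T - 1) ((1 - u) + u T)\<^sup>-\<^sup>1\<close> gives a
bounded \<open>A\<close> with \<open>exp A = T\<close> (\<open>exp_minus_neg_log\<close>), and \<open>exp (t A)\<close> is the group.

In the second part \<open>T\<close> need not be invertible, but each \<open>e + T\<close> with \<open>e > 0\<close> has a logarithm by the
first construction, hence powers \<open>(e + T)\<^sup>t\<close> that form a group in \<open>t\<close>. The point is that these powers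
converge as \<open>e\<close> tends to \<open>0\<close>. Euler's integral
  \<open>B(a, 1 - a) * (1 - N)\<^sup>-\<^sup>a = \<integral> y\<^sup>a\<^sup>-\<^sup>1 (1 - y)\<^sup>-\<^sup>a (1 - y N)\<^sup>-\<^sup>1 dy\<close>  over \<open>0 < y < 1\<close>
is valid for these operators (\<open>beta_mean_exp_neg_log\<close>), since both sides solve the same linear
differential equation when \<open>N\<close> is replaced by \<open>u N\<close>. As its density is positive, it reduces operator
estimates to scalar ones with the same constant. The resolvent bounds then yield
\<open>norm ((e + T)\<^sup>t - (d + T)\<^sup>t) \<le> M\<^sup>2 (e\<^sup>t - d\<^sup>t)\<close> for \<open>0 < d \<le> e\<close> and \<open>0 < t \<le> 1\<close>
(\<open>norm_powr_shift_diff\<close>). So the powers converge in norm, uniformly for \<open>t\<close> in compact parts of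
\<open>{0<..1}\<close>, and stay bounded there; the semigroup law passes to the limit, and the limit at \<open>t = 1\<close> is
\<open>T\<close>. Strong continuity at \<open>0\<close> holds on the range of \<open>T\<close> by the semigroup law, hence everywhere because
that range is dense (\<open>nonnegative_operator_semigroup\<close>).
\<close>

section \<open>Logarithms along an invertible segment of a Banach algebra\<close>

lemma exp_has_derivative_at_0:
  "((exp :: 'b::{real_normed_algebra_1,banach} \<Rightarrow> 'b) has_derivative (\<lambda>h. h)) (at 0)"
  unfolding has_derivative_iff_norm
proof
  show "((\<lambda>h::'b. norm (exp h - exp 0 - (h - 0)) / norm (h - 0)) \<longlongrightarrow> 0) (at 0)"
  proof (rule Lim_null_comparison)
    have "norm (exp h - 1 - h) \<le> (norm h)\<^sup>2" if "norm h < 1" for h :: 'b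
    proof -
      have summable: "summable (\<lambda>n. inverse (fact (n + 2)) *\<^sub>R norm h ^ (n + 2))"
        using summable_exp_generic[of "norm h"] by (subst summable_iff_shift) auto
      have "norm (exp h - 1 - h) = norm (\<Sum>n. inverse (fact (n + 2)) *\<^sub>R h ^ (n + 2))"
        by (simp add: exp_first_two_terms[of h])
      also have "\<dots> \<le> (\<Sum>n. inverse (fact (n + 2)) *\<^sub>R norm h ^ (n + 2))"
        by (rule norm_suminf_le[OF _ summable]) (simp add: norm_power_ineq mult_left_mono del: power_Suc power_add)
      also have "\<dots> = exp (norm h) - 1 - norm h"
        by (simp add: exp_first_two_terms[of "norm h"])
      also have "\<dots> \<le> (norm h)\<^sup>2"
        using exp_bound[of "norm h"] that by simp
      finally show ?thesis .
    qed
    then have "norm (norm (exp h - exp 0 - (h - 0)) / norm (h - 0)) \<le> norm h"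
      if "norm h < 1" for h :: 'b
      using that by (cases "h = 0") (auto simp: divide_simps power2_eq_square)
    then show "\<forall>\<^sub>F h::'b in at 0. norm (norm (exp h - exp 0 - (h - 0)) / norm (h - 0)) \<le> norm h"
      by (auto simp: eventually_at intro!: exI[of _ 1])
    show "(norm \<longlongrightarrow> 0) (at (0::'b))"
      by (rule tendsto_norm_zero) (rule tendsto_ident_at)
  qed
qed (rule bounded_linear_ident)

text \<open>Without commutativity the chain rule for the exponential fails. The commutation hypothesis
  reduces it to the derivative at \<open>0\<close>, through \<open>exp (f s) = exp (f t) * exp (f s - f t)\<close>.\<close>

lemma exp_commuting_has_vector_derivative:
  fixes f :: "real \<Rightarrow> 'b::{real_normed_algebra_1,banach}"
  assumes f: "(f has_vector_derivative f') (at t within S)"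
    and comm: "\<And>s. s \<in> S \<Longrightarrow> f s * f t = f t * f s"
    and t: "t \<in> S"
  shows "((\<lambda>s. exp (f s)) has_vector_derivative exp (f t) * f') (at t within S)"
proof -
  have "((\<lambda>s. f s - f t) has_derivative (\<lambda>h. h *\<^sub>R f')) (at t within S)"
    using f by (auto simp: has_vector_derivative_def intro!: derivative_eq_intros)
  moreover have "(exp has_derivative (\<lambda>h. h)) (at (f t - f t))"
    by (simp add: exp_has_derivative_at_0)
  ultimately have "((\<lambda>s. exp (f s - f t)) has_derivative (\<lambda>h. h *\<^sub>R f')) (at t within S)"
    by (rule has_derivative_compose)
  then have "((\<lambda>s. exp (f t) * exp (f s - f t)) has_vector_derivative exp (f t) * f') (at t within S)"
    unfolding has_vector_derivative_def[symmetric]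
    by (rule has_vector_derivative_mult_right)
  then show ?thesis
  proof (rule has_vector_derivative_transform[OF t, rotated])
    fix s assume "s \<in> S"
    then show "exp (f s) = exp (f t) * exp (f s - f t)"
      by (subst exp_add_commuting[symmetric]) (simp_all add: comm algebra_simps)
  qed
qed

lemma integral_commute:
  fixes f :: "real \<Rightarrow> 'b::{real_normed_algebra_1,banach}"
  assumes "\<And>x. x \<in> S \<Longrightarrow> f x * a = a * f x" and "f integrable_on S"
  shows "integral S f * a = a * integral S f"
proof -
  have "integral S f * a = integral S ((\<lambda>x. x * a) \<circ> f)"
    by (rule integral_linear[symmetric]) (simp_all add: assms bounded_linear_mult_left)
  also have "\<dots> = integral S ((\<lambda>x. a * x) \<circ> f)"
    by (rule integral_cong) (simp add: assms)
  also have "\<dots> = a * integral S f"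
    by (rule integral_linear) (simp_all add: assms bounded_linear_mult_right)
  finally show ?thesis .
qed

text \<open>Writing \<open>B = 1 - N\<close>, the element \<open>1 - u *\<^sub>R N\<close> runs along the segment from \<open>1\<close> to \<open>B\<close>. If
  no point of \<open>(-\<infinity>, 0]\<close> lies in the spectrum of \<open>B\<close>, then this whole segment is invertible, because
  \<open>(1 - u) + u B = u ((1 - u) / u + B)\<close>; the family \<open>R\<close> of inverses is an explicit datum.\<close>

locale invertible_segment =
  fixes N :: "'b::{real_normed_algebra_1,banach}" and R :: "real \<Rightarrow> 'b"
  assumes R_left: "u \<in> {0..1} \<Longrightarrow> R u * (1 - u *\<^sub>R N) = 1"
    and R_right: "u \<in> {0..1} \<Longrightarrow> (1 - u *\<^sub>R N) * R u = 1"
begin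

lemma R_0: "R 0 = 1"
  using R_left[of 0] by simp

lemma R_commute:
  assumes "a * N = N * a" and u: "u \<in> {0..1}"
  shows "R u * a = a * R u"
proof -
  have "(1 - u *\<^sub>R N) * a = a * (1 - u *\<^sub>R N)"
    by (simp add: algebra_simps assms)
  then have "R u * ((1 - u *\<^sub>R N) * a) * R u = R u * (a * (1 - u *\<^sub>R N)) * R u"
    by simp
  moreover have "R u * ((1 - u *\<^sub>R N) * a) * R u = a * R u"
    using R_left[OF u] by (simp flip: mult.assoc)
  moreover have "R u * (a * (1 - u *\<^sub>R N)) * R u = R u * a"
    using R_right[OF u] by (simp add: mult.assoc)
  ultimately show ?thesis by simp
qed

lemma R_N_commute: "u \<in> {0..1} \<Longrightarrow> R u * N = N * R u"
  by (rule R_commute) simp_all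

lemma R_diff:
  assumes u: "u \<in> {0..1}" and v: "v \<in> {0..1}"
  shows "R v - R u = (v - u) *\<^sub>R (R v * N * R u)"
proof -
  have "R v - R u = R v * ((1 - u *\<^sub>R N) * R u) - (R v * (1 - v *\<^sub>R N)) * R u"
    by (simp only: R_left[OF v] R_right[OF u]) simp
  also have "\<dots> = R v * ((1 - u *\<^sub>R N) - (1 - v *\<^sub>R N)) * R u"
    by (simp only: mult.assoc right_diff_distrib left_diff_distrib)
  finally show ?thesis
    by (simp add: algebra_simps)
qed

text \<open>The identity \<open>R_diff\<close> bounds \<open>R v\<close> near \<open>u\<close> by \<open>2 * norm (R u)\<close> and then forces \<open>R v\<close> to tend to \<open>R u\<close>.\<close>

lemma continuous_on_R: "continuous_on {0..1} R"
  unfolding continuous_on_def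
proof
  fix u :: real assume u: "u \<in> {0..1}"
  define c where "c = norm N * norm (R u)"
  have "((\<lambda>v. R v - R u) \<longlongrightarrow> 0) (at u within {0..1})"
  proof (rule Lim_null_comparison)
    have "((\<lambda>v. \<bar>v - u\<bar> * c) \<longlongrightarrow> \<bar>u - u\<bar> * c) (at u within {0..1})"
      by (intro tendsto_intros)
    then have "\<forall>\<^sub>F v in at u within {0..1}. \<bar>v - u\<bar> * c < 1/2"
      by (rule order_tendstoD) simp
    moreover have "\<forall>\<^sub>F v in at u within {0..1}. v \<in> {0..1}"
      by (simp add: eventually_at_filter)
    ultimately show "\<forall>\<^sub>F v in at u within {0..1}. norm (R v - R u) \<le> \<bar>v - u\<bar> * c * (2 * norm (R u))"
    proof eventually_elim
      case (elim v)
      have "norm (R v - R u) = \<bar>v - u\<bar> * norm (R v * N * R u)"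
        by (simp add: R_diff[OF u elim(2)])
      also have "\<dots> \<le> \<bar>v - u\<bar> * (norm (R v) * norm N * norm (R u))"
        by (intro mult_left_mono order_trans[OF norm_mult_ineq] mult_right_mono) auto
      finally have *: "norm (R v - R u) \<le> \<bar>v - u\<bar> * c * norm (R v)"
        by (simp add: c_def mult_ac)
      also have "\<dots> \<le> 1/2 * norm (R v)"
        using elim by (intro mult_right_mono) auto
      finally have "norm (R v) \<le> 2 * norm (R u)"
        using norm_triangle_ineq2[of "R v" "R u"] by simp
      then have "\<bar>v - u\<bar> * c * norm (R v) \<le> \<bar>v - u\<bar> * c * (2 * norm (R u))"
        by (intro mult_left_mono) (auto simp: c_def)
      with * show ?case by simp
    qed
    show "((\<lambda>v. \<bar>v - u\<bar> * c * (2 * norm (R u))) \<longlongrightarrow> 0) (at u within {0..1})"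
      by (auto intro!: tendsto_eq_intros)
  qed
  then show "(R \<longlongrightarrow> R u) (at u within {0..1})"
    by (rule LIM_zero_cancel)
qed

lemma R_bounded:
  obtains K where "K > 0" and "\<And>u. u \<in> {0..1} \<Longrightarrow> norm (R u) \<le> K"
proof -
  have "bounded (R ` {0..1})"
    by (intro compact_imp_bounded compact_continuous_image continuous_on_R) simp
  then show thesis
    using that by (auto simp: bounded_pos)
qed

lemma R_has_vector_derivative:
  assumes u: "u \<in> {0..1}"
  shows "(R has_vector_derivative N * R u * R u) (at u within {0..1})"
  unfolding has_vector_derivative_def has_derivative_iff_norm
proof
  show "bounded_linear (\<lambda>h. h *\<^sub>R (N * R u * R u))"
    by (rule bounded_linear_scaleR_left)
  have "((\<lambda>v. R v * N * R u - N * R u * R u) \<longlongrightarrow> R u * N * R u - N * R u * R u) (at u within {0..1})"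
    using continuous_on_R u unfolding continuous_on_def by (intro tendsto_intros) auto
  then have lim: "((\<lambda>v. norm (R v * N * R u - N * R u * R u)) \<longlongrightarrow> 0) (at u within {0..1})"
    by (intro tendsto_norm_zero) (simp only: R_N_commute[OF u] diff_self)
  show "((\<lambda>v. norm (R v - R u - (v - u) *\<^sub>R (N * R u * R u)) / norm (v - u)) \<longlongrightarrow> 0)
    (at u within {0..1})"
  proof (rule Lim_transform_within[OF lim zero_less_one])
    fix v assume v: "v \<in> {0..1}" "0 < dist v u"
    have "R v - R u - (v - u) *\<^sub>R (N * R u * R u) = (v - u) *\<^sub>R (R v * N * R u - N * R u * R u)"
      by (simp add: R_diff[OF u v(1)] scaleR_diff_right)
    with v show "norm (R v * N * R u - N * R u * R u)
        = norm (R v - R u - (v - u) *\<^sub>R (N * R u * R u)) / norm (v - u)"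
      by simp
  qed
qed

text \<open>This is \<open>- log (1 - u *\<^sub>R N)\<close>, as the integral of the logarithmic derivative along the
  segment.\<close>

definition neg_log :: "real \<Rightarrow> 'b" where
  "neg_log u = integral {0..u} (\<lambda>v. N * R v)"

lemma continuous_on_N_R: "continuous_on {0..1} (\<lambda>v. N * R v)"
  by (intro continuous_intros continuous_on_R)

lemma neg_log_has_vector_derivative:
  "u \<in> {0..1} \<Longrightarrow> (neg_log has_vector_derivative N * R u) (at u within {0..1})"
  unfolding neg_log_def by (rule integral_has_vector_derivative[OF continuous_on_N_R])

lemma neg_log_commute:
  assumes "a * N = N * a" and "u \<in> {0..1}"
  shows "neg_log u * a = a * neg_log u"
  unfolding neg_log_def
proof (rule integral_commute)
  show "(\<lambda>v. N * R v) integrable_on {0..u}"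
    using assms by (intro integrable_continuous_real continuous_on_subset[OF continuous_on_N_R]) auto
  fix v assume "v \<in> {0..u}"
  then have "R v * a = a * R v"
    using assms by (intro R_commute) auto
  then show "N * R v * a = a * (N * R v)"
    by (metis assms(1) mult.assoc)
qed

lemma neg_log_neg_log_commute:
  "u \<in> {0..1} \<Longrightarrow> v \<in> {0..1} \<Longrightarrow> neg_log u * neg_log v = neg_log v * neg_log u"
  by (intro neg_log_commute) (simp_all add: neg_log_commute)

lemma exp_neg_log_has_vector_derivative:
  assumes u: "u \<in> {0..1}"
  shows "((\<lambda>u. exp (a *\<^sub>R neg_log u)) has_vector_derivative
    exp (a *\<^sub>R neg_log u) * (a *\<^sub>R (N * R u))) (at u within {0..1})"
proof (rule exp_commuting_has_vector_derivative[OF _ _ u])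
  show "((\<lambda>u. a *\<^sub>R neg_log u) has_vector_derivative a *\<^sub>R (N * R u)) (at u within {0..1})"
    using neg_log_has_vector_derivative[OF u] by (auto intro!: derivative_eq_intros)
qed (simp add: neg_log_neg_log_commute[OF _ u])

text \<open>The function \<open>exp (neg_log u) * (1 - u *\<^sub>R N)\<close> is constant, as its two derivative terms
  cancel.\<close>

lemma exp_minus_neg_log: "exp (- neg_log 1) = 1 - N"
proof -
  define F where "F u = exp (1 *\<^sub>R neg_log u) * (1 - u *\<^sub>R N)" for u
  have "(F has_vector_derivative 0) (at u within {0..1})" if u: "u \<in> {0..1}" for u
  proof -
    have *: "N * (R u * (1 - u *\<^sub>R N)) = N"
      using R_left[OF u] by simp
    have "((\<lambda>u. 1 - u *\<^sub>R N) has_vector_derivative - N) (at u within {0..1})"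
      by (auto intro!: derivative_eq_intros)
    from has_vector_derivative_mult[OF exp_neg_log_has_vector_derivative[OF u, of 1] this]
    show ?thesis
      by (simp add: F_def[abs_def] mult.assoc *)
  qed
  then obtain c where "\<And>u. u \<in> {0..1} \<Longrightarrow> F u = c"
    by (rule has_vector_derivative_zero_constant[rotated]) auto
  then have "F 1 = F 0"
    by simp
  then have "exp (neg_log 1) * (1 - N) = 1"
    by (simp add: F_def neg_log_def)
  then have "exp (- neg_log 1) * (exp (neg_log 1) * (1 - N)) = exp (- neg_log 1)"
    by simp
  then show ?thesis
    using exp_minus_inverse[of "- neg_log 1"] by (simp flip: mult.assoc)
qed

end

section \<open>Weighted means for the Beta density\<close>

definition beta_weight :: "real \<Rightarrow> real \<Rightarrow> real" where
  "beta_weight a y = y powr (a - 1) * (1 - y) powr (- a)"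

text \<open>For \<open>0 < a < 1\<close> this means that \<open>x\<close> is the mean of \<open>f\<close> under the Beta distribution with parameters
  \<open>a\<close> and \<open>1 - a\<close>. Comparing the truncated integral with the truncated mass times \<open>x\<close> keeps every
  integral proper, and the same masses occur in the operator case and in the scalar case.\<close>

definition beta_mean :: "real \<Rightarrow> (real \<Rightarrow> 'b::real_normed_vector) \<Rightarrow> 'b \<Rightarrow> bool" where
  "beta_mean a f x \<longleftrightarrow> continuous_on {0..1} f \<and>
    ((\<lambda>\<eta>. integral {\<eta>..1 - \<eta>} (\<lambda>y. beta_weight a y *\<^sub>R f y)
        - integral {\<eta>..1 - \<eta>} (beta_weight a) *\<^sub>R x) \<longlongrightarrow> 0) (at_right 0)"

lemma beta_weight_pos: "0 < y \<Longrightarrow> y < 1 \<Longrightarrow> 0 < beta_weight a y"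
  by (simp add: beta_weight_def)

lemma beta_weight_nonneg [simp]: "0 \<le> beta_weight a y"
  by (simp add: beta_weight_def)

lemma continuous_on_beta_weight: "0 < \<eta> \<Longrightarrow> continuous_on {\<eta>..1 - \<eta>} (beta_weight a)"
  unfolding beta_weight_def by (intro continuous_intros) auto

lemma beta_weight_scaleR_integrable:
  fixes f :: "real \<Rightarrow> 'b::banach"
  assumes "0 < \<eta>" and "continuous_on {0..1} f"
  shows "(\<lambda>y. beta_weight a y *\<^sub>R f y) integrable_on {\<eta>..1 - \<eta>}"
  using assms
  by (intro integrable_continuous_real continuous_on_scaleR continuous_on_beta_weight)
    (auto elim: continuous_on_subset)

lemma eventually_at_right_0_less: "0 < (c::real) \<Longrightarrow> \<forall>\<^sub>F \<eta> in at_right 0. 0 < \<eta> \<and> \<eta> < c"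
  using eventually_at_right_less eventually_at_right[of 0 c]
  by (auto intro!: eventually_conj)

lemma beta_mean_diff:
  fixes f g :: "real \<Rightarrow> 'b::banach"
  assumes f: "beta_mean a f x" and g: "beta_mean a g y"
  shows "beta_mean a (\<lambda>u. f u - g u) (x - y)"
  unfolding beta_mean_def
proof
  show "continuous_on {0..1} (\<lambda>u. f u - g u)"
    using f g by (auto simp: beta_mean_def intro: continuous_on_diff)
  let ?c = "\<lambda>\<eta>. integral {\<eta>..1 - \<eta>} (beta_weight a)"
  let ?I = "\<lambda>h \<eta>. integral {\<eta>..1 - \<eta>} (\<lambda>y. beta_weight a y *\<^sub>R h y)"
  have "((\<lambda>\<eta>. (?I f \<eta> - ?c \<eta> *\<^sub>R x) - (?I g \<eta> - ?c \<eta> *\<^sub>R y)) \<longlongrightarrow> 0 - 0) (at_right 0)"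
    using f g unfolding beta_mean_def by (intro tendsto_diff) auto
  moreover have "\<forall>\<^sub>F \<eta> in at_right 0. (?I f \<eta> - ?c \<eta> *\<^sub>R x) - (?I g \<eta> - ?c \<eta> *\<^sub>R y)
      = ?I (\<lambda>u. f u - g u) \<eta> - ?c \<eta> *\<^sub>R (x - y)"
    using eventually_at_right_0_less[OF zero_less_one]
  proof eventually_elim
    case (elim \<eta>)
    have "?I (\<lambda>u. f u - g u) \<eta> = ?I f \<eta> - ?I g \<eta>"
      using f g elim by (simp add: scaleR_diff_right beta_mean_def integral_diff
          beta_weight_scaleR_integrable)
    then show ?case
      by (simp add: algebra_simps)
  qed
  ultimately show "((\<lambda>\<eta>. ?I (\<lambda>u. f u - g u) \<eta> - ?c \<eta> *\<^sub>R (x - y)) \<longlongrightarrow> 0) (at_right 0)"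
    by (simp add: filterlim_cong)
qed

lemma beta_mean_bounded_linear:
  fixes f :: "real \<Rightarrow> 'b::banach" and h :: "'b \<Rightarrow> 'c::banach"
  assumes f: "beta_mean a f x" and h: "bounded_linear h"
  shows "beta_mean a (\<lambda>u. h (f u)) (h x)"
  unfolding beta_mean_def
proof
  interpret h: bounded_linear h by (rule h)
  show "continuous_on {0..1} (\<lambda>u. h (f u))"
    using f by (auto simp: beta_mean_def intro: h.continuous_on)
  let ?c = "\<lambda>\<eta>. integral {\<eta>..1 - \<eta>} (beta_weight a)"
  let ?I = "\<lambda>\<eta>. integral {\<eta>..1 - \<eta>} (\<lambda>y. beta_weight a y *\<^sub>R f y)"
  have "((\<lambda>\<eta>. h (?I \<eta> - ?c \<eta> *\<^sub>R x)) \<longlongrightarrow> 0) (at_right 0)"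
    using f unfolding beta_mean_def by (auto intro: h.tendsto_zero)
  moreover have "\<forall>\<^sub>F \<eta> in at_right 0. h (?I \<eta> - ?c \<eta> *\<^sub>R x)
      = integral {\<eta>..1 - \<eta>} (\<lambda>y. beta_weight a y *\<^sub>R h (f y)) - ?c \<eta> *\<^sub>R h x"
    using eventually_at_right_0_less[OF zero_less_one]
  proof eventually_elim
    case (elim \<eta>)
    have "integral {\<eta>..1 - \<eta>} (h \<circ> (\<lambda>y. beta_weight a y *\<^sub>R f y)) = h (?I \<eta>)"
      using f elim by (intro integral_linear h) (simp add: beta_mean_def beta_weight_scaleR_integrable)
    then show ?case
      by (simp add: h.diff h.scaleR o_def)
  qed
  ultimately show "((\<lambda>\<eta>. integral {\<eta>..1 - \<eta>} (\<lambda>y. beta_weight a y *\<^sub>R h (f y)) - ?c \<eta> *\<^sub>R h x)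
      \<longlongrightarrow> 0) (at_right 0)"
    by (simp add: filterlim_cong)
qed

text \<open>A mean for a positive density is monotone, so an estimate in a Banach algebra follows from a
  pointwise comparison with a scalar function whose mean is known. If the conclusion failed, then the
  gap would be multiplied by a truncated mass that is bounded below, while the errors tend to \<open>0\<close>.\<close>

lemma beta_mean_norm_le:
  fixes f :: "real \<Rightarrow> 'b::banach"
  assumes f: "beta_mean a f x" and g: "beta_mean a g r"
    and le: "\<And>y. 0 < y \<Longrightarrow> y < 1 \<Longrightarrow> norm (f y) \<le> g y"
  shows "norm x \<le> r"
proof -
  let ?c = "\<lambda>\<eta>. integral {\<eta>..1 - \<eta>} (beta_weight a)"
  let ?If = "\<lambda>\<eta>. integral {\<eta>..1 - \<eta>} (\<lambda>y. beta_weight a y *\<^sub>R f y)"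
  let ?Ig = "\<lambda>\<eta>. integral {\<eta>..1 - \<eta>} (\<lambda>y. beta_weight a y *\<^sub>R g y)"
  let ?e = "\<lambda>\<eta>. norm (?If \<eta> - ?c \<eta> *\<^sub>R x) + norm (?Ig \<eta> - ?c \<eta> *\<^sub>R r)"
  have lim: "(?e \<longlongrightarrow> 0) (at_right 0)"
    using f g unfolding beta_mean_def by (intro tendsto_add_zero tendsto_norm_zero) auto
  define c0 where "c0 = ?c (1/4)"
  have quarter: "0 < (1/4 :: real)" by simp
  have ev: "\<forall>\<^sub>F \<eta> in at_right 0. c0 \<le> ?c \<eta> \<and> ?c \<eta> * (norm x - r) \<le> ?e \<eta>"
    using eventually_at_right_0_less[OF quarter]
  proof eventually_elim
    case \<eta>: (elim \<eta>)
    have "c0 \<le> ?c \<eta>"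
      unfolding c0_def using \<eta>
      by (intro integral_subset_le integrable_continuous_real continuous_on_beta_weight)
        auto
    have "norm (?If \<eta>) \<le> ?Ig \<eta>"
      using f g \<eta>
      by (intro integral_norm_bound_integral beta_weight_scaleR_integrable)
        (auto simp: beta_mean_def beta_weight_pos le)
    moreover have "?c \<eta> * norm x = norm (?c \<eta> *\<^sub>R x)"
      using \<eta> by (simp add: integral_nonneg integrable_continuous_real continuous_on_beta_weight)
    moreover have "norm (?c \<eta> *\<^sub>R x) \<le> norm (?If \<eta>) + norm (?If \<eta> - ?c \<eta> *\<^sub>R x)"
      using norm_triangle_ineq4[of "?If \<eta>" "?If \<eta> - ?c \<eta> *\<^sub>R x"] by simp
    moreover have "?Ig \<eta> \<le> ?c \<eta> * r + norm (?Ig \<eta> - ?c \<eta> *\<^sub>R r)"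
      by simp
    ultimately show ?case
      using \<open>c0 \<le> ?c \<eta>\<close> unfolding right_diff_distrib by linarith
  qed
  have "0 < c0"
  proof -
    have "0 \<le> c0" unfolding c0_def
      by (intro integral_nonneg integrable_continuous_real continuous_on_beta_weight)
        auto
    moreover have "c0 \<noteq> 0"
    proof
      assume "c0 = 0"
      then have "beta_weight a (1/2) = 0"
        using integral_eq_0_iff[of "1/4" "1 - 1/4" "beta_weight a"]
        by (auto simp: c0_def continuous_on_beta_weight[of "1/4", simplified])
      then show False
        using beta_weight_pos[of "1/2" a] by simp
    qed
    ultimately show ?thesis by simp
  qed
  show ?thesis
  proof (rule ccontr)
    assume "\<not> norm x \<le> r"
    then have "0 < c0 * (norm x - r)"
      using \<open>0 < c0\<close> by simp
    then have "\<forall>\<^sub>F \<eta> in at_right 0. ?e \<eta> < c0 * (norm x - r)"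
      using lim by (rule order_tendstoD(2)[rotated])
    with ev have "\<forall>\<^sub>F \<eta> in at_right (0::real). False"
    proof eventually_elim
      case (elim \<eta>)
      have "c0 * (norm x - r) \<le> ?c \<eta> * (norm x - r)"
        using elim(1) \<open>\<not> norm x \<le> r\<close> by (intro mult_right_mono) auto
      with elim show False by linarith
    qed
    then show False by simp
  qed
qed

section \<open>Euler's integral for fractional powers\<close>

text \<open>The scalar factor of the boundary term when the Beta integral is integrated by parts. It vanishes at both
  endpoints, and this is why truncation costs nothing in the limit.\<close>

definition beta_boundary :: "real \<Rightarrow> real \<Rightarrow> real" where
  "beta_boundary a y = y powr a * (1 - y) powr (1 - a)"

lemma beta_boundary_has_real_derivative:
  assumes "0 < y" "y < 1"
  shows "(beta_boundary a has_real_derivative beta_weight a y * (a - y)) (at y within S)"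
proof -
  have "y powr a = y powr (a - 1) * y" "(1 - y) powr (1 - a) = (1 - y) powr (- a) * (1 - y)"
    using assms powr_add[of y "a - 1" 1] powr_add[of "1 - y" "- a" 1] by simp_all
  with assms show ?thesis
    unfolding beta_boundary_def[abs_def] beta_weight_def
    by (auto intro!: derivative_eq_intros simp: divide_simps) (simp add: algebra_simps)
qed

lemma beta_boundary_eq:
  assumes "0 < y" "y < 1"
  shows "beta_boundary a y = beta_weight a y * (y * (1 - y))"
  using assms powr_add[of y "a - 1" 1] powr_add[of "1 - y" "- a" 1]
  by (simp add: beta_boundary_def beta_weight_def)

lemma beta_boundary_tendsto_0:
  assumes "0 < a" "a < 1"
  shows "((\<lambda>\<eta>. beta_boundary a \<eta> + beta_boundary a (1 - \<eta>)) \<longlongrightarrow> 0) (at_right 0)"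
proof -
  have *: "((\<lambda>\<eta>::real. \<eta> powr b) \<longlongrightarrow> 0) (at_right 0)" if "0 < b" for b
  proof -
    have "continuous_on {0..} (\<lambda>\<eta>::real. \<eta> powr b)"
      using that by (intro continuous_on_powr' continuous_intros) auto
    then have "((\<lambda>\<eta>::real. \<eta> powr b) \<longlongrightarrow> 0 powr b) (at 0 within {0..})"
      unfolding continuous_on_def by (rule bspec) simp
    then show ?thesis
      by (auto intro: tendsto_within_subset)
  qed
  have **: "((\<lambda>\<eta>::real. (1 - \<eta>) powr b) \<longlongrightarrow> 1) (at_right 0)" for b
    by (auto intro!: tendsto_eq_intros)
  show ?thesis
    unfolding beta_boundary_def
    using tendsto_add[OF tendsto_mult[OF *[of a] **[of "1 - a"]] tendsto_mult[OF **[of a] *[of "1 - a"]]]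
    using assms by simp
qed

context invertible_segment
begin

text \<open>Integrating the derivative of \<open>beta_boundary a y *\<^sub>R R (u * y)\<close> shows that, up to the boundary
  term \<open>N * D\<close>, the integral \<open>J u\<close> satisfies \<open>(1 - u *\<^sub>R N) * J' = a *\<^sub>R (N * J)\<close>. This is the linear
  differential equation of \<open>exp (a *\<^sub>R neg_log u)\<close>.\<close>

lemma beta_integration_by_parts:
  fixes a \<eta> u :: real
  assumes \<eta>: "0 < \<eta>" "\<eta> < 1/2" and u: "u \<in> {0..1}"
  defines "J \<equiv> integral {\<eta>..1 - \<eta>} (\<lambda>y. beta_weight a y *\<^sub>R R (u * y))"
    and "J' \<equiv> integral {\<eta>..1 - \<eta>} (\<lambda>y. beta_weight a y *\<^sub>R (y *\<^sub>R (N * R (u * y) * R (u * y))))"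
    and "D \<equiv> beta_boundary a (1 - \<eta>) *\<^sub>R R (u * (1 - \<eta>)) - beta_boundary a \<eta> *\<^sub>R R (u * \<eta>)"
  shows "(1 - u *\<^sub>R N) * J' = a *\<^sub>R (N * J) - N * D"
proof -
  let ?w = "beta_weight a"
  let ?\<rho> = "\<lambda>y. R (u * y)"
  have uy: "u * y \<in> {0..1}" if "y \<in> {0..1}" for y
    using u that by (auto intro: mult_le_one)
  have cont: "continuous_on {0..1} ?\<rho>"
    by (rule continuous_on_compose2[OF continuous_on_R]) (auto intro!: continuous_intros uy)
  have deriv: "((\<lambda>y. beta_boundary a y *\<^sub>R ?\<rho> y) has_vector_derivative
      beta_boundary a y *\<^sub>R (u *\<^sub>R (N * ?\<rho> y * ?\<rho> y)) + (?w y * (a - y)) *\<^sub>R ?\<rho> y)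
      (at y within {\<eta>..1 - \<eta>})" if y: "y \<in> {\<eta>..1 - \<eta>}" for y
  proof (rule has_vector_derivative_scaleR)
    show "(beta_boundary a has_real_derivative ?w y * (a - y)) (at y within {\<eta>..1 - \<eta>})"
      using y \<eta> by (intro beta_boundary_has_real_derivative) auto
    have "((\<lambda>y. u * y) has_vector_derivative u) (at y within {\<eta>..1 - \<eta>})"
      by (auto intro!: derivative_eq_intros)
    moreover have "(R has_vector_derivative N * R (u * y) * R (u * y))
        (at (u * y) within ((*) u ` {\<eta>..1 - \<eta>}))"
    proof (rule has_vector_derivative_within_subset[OF R_has_vector_derivative])
      have "v \<in> {0..1}" if "v \<in> {\<eta>..1 - \<eta>}" for v
        using that \<eta> by auto
      then show "u * y \<in> {0..1}" "(*) u ` {\<eta>..1 - \<eta>} \<subseteq> {0..1}"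
        using uy y by blast+
    qed
    ultimately show "(?\<rho> has_vector_derivative u *\<^sub>R (N * ?\<rho> y * ?\<rho> y)) (at y within {\<eta>..1 - \<eta>})"
      by (rule vector_diff_chain_within[unfolded o_def])
  qed
  have "((\<lambda>y. beta_boundary a y *\<^sub>R (u *\<^sub>R (N * ?\<rho> y * ?\<rho> y)) + (?w y * (a - y)) *\<^sub>R ?\<rho> y)
      has_integral D) {\<eta>..1 - \<eta>}"
    unfolding D_def by (rule fundamental_theorem_of_calculus) (use \<eta> deriv in auto)
  then have 1: "((\<lambda>y. N * (beta_boundary a y *\<^sub>R (u *\<^sub>R (N * ?\<rho> y * ?\<rho> y)) + (?w y * (a - y)) *\<^sub>R ?\<rho> y))
      has_integral N * D) {\<eta>..1 - \<eta>}"
    by (rule has_integral_linear[OF _ bounded_linear_mult_right, unfolded o_def])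
  have J: "((\<lambda>y. ?w y *\<^sub>R ?\<rho> y) has_integral J) {\<eta>..1 - \<eta>}"
    unfolding J_def using \<eta> by (intro integrable_integral beta_weight_scaleR_integrable cont)
  have J': "((\<lambda>y. ?w y *\<^sub>R (y *\<^sub>R (N * ?\<rho> y * ?\<rho> y))) has_integral J') {\<eta>..1 - \<eta>}"
    unfolding J'_def using \<eta>
    by (intro integrable_integral beta_weight_scaleR_integrable continuous_intros cont)
  have 2: "((\<lambda>y. a *\<^sub>R (N * (?w y *\<^sub>R ?\<rho> y)) - (1 - u *\<^sub>R N) * (?w y *\<^sub>R (y *\<^sub>R (N * ?\<rho> y * ?\<rho> y))))
      has_integral a *\<^sub>R (N * J) - (1 - u *\<^sub>R N) * J') {\<eta>..1 - \<eta>}"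
    by (intro has_integral_diff has_integral_cmul
        has_integral_linear[OF J bounded_linear_mult_right, unfolded o_def]
        has_integral_linear[OF J' bounded_linear_mult_right, unfolded o_def])
  have "N * D = a *\<^sub>R (N * J) - (1 - u *\<^sub>R N) * J'"
  proof (rule has_integral_unique[OF 1 has_integral_eq[OF _ 2]])
    fix y assume y: "y \<in> {\<eta>..1 - \<eta>}"
    then have "u * y \<in> {0..1}"
      using \<eta> by (intro uy) auto
    note R = R_right[OF this] R_N_commute[OF this]
    define \<rho> where "\<rho> = ?\<rho> y"
    \<comment> \<open>The integrands agree because of the quadratic relation that \<open>(1 - u y N) \<rho> = 1\<close> imposes on \<open>\<rho>\<close>.\<close>
    have "\<rho> * \<rho> = \<rho> + (u * y) *\<^sub>R (N * \<rho> * \<rho>)"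
    proof -
      have "(1 - (u * y) *\<^sub>R N) * \<rho> * \<rho> = \<rho>"
        unfolding \<rho>_def R by simp
      then show ?thesis
        by (simp add: algebra_simps)
    qed
    then have "N * \<rho> * \<rho> = N * \<rho> + (u * y) *\<^sub>R (N * N * \<rho> * \<rho>)"
      by (metis distrib_left mult.assoc mult_scaleR_right)
    from arg_cong[OF this, of "(*\<^sub>R) y"]
    have "y *\<^sub>R (N * \<rho> * \<rho>) = y *\<^sub>R (N * \<rho>) + (u * y * y) *\<^sub>R (N * N * \<rho> * \<rho>)"
      by (simp only: scaleR_add_right scaleR_scaleR mult.commute mult.left_commute)
    then have "(a *\<^sub>R (N * \<rho>) - y *\<^sub>R (N * \<rho> * \<rho>) + (u * y) *\<^sub>R (N * N * \<rho> * \<rho>))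
      = (a - y) *\<^sub>R (N * \<rho>) + (y * (1 - y) * u) *\<^sub>R (N * N * \<rho> * \<rho>)"
      by (simp add: algebra_simps)
    then have "?w y *\<^sub>R (a *\<^sub>R (N * \<rho>) - y *\<^sub>R (N * \<rho> * \<rho>) + (u * y) *\<^sub>R (N * N * \<rho> * \<rho>))
      = ?w y *\<^sub>R ((a - y) *\<^sub>R (N * \<rho>) + (y * (1 - y) * u) *\<^sub>R (N * N * \<rho> * \<rho>))"
      by simp
    moreover have bb: "beta_boundary a y = ?w y * (y * (1 - y))"
      using y \<eta> by (intro beta_boundary_eq) auto
    ultimately show "a *\<^sub>R (N * (?w y *\<^sub>R ?\<rho> y)) - (1 - u *\<^sub>R N) * (?w y *\<^sub>R (y *\<^sub>R (N * ?\<rho> y * ?\<rho> y)))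
      = N * (beta_boundary a y *\<^sub>R (u *\<^sub>R (N * ?\<rho> y * ?\<rho> y)) + (?w y * (a - y)) *\<^sub>R ?\<rho> y)"
      unfolding \<rho>_def[symmetric] bb by (simp add: algebra_simps)
  qed
  then show ?thesis by simp
qed

lemma beta_integral_has_vector_derivative:
  fixes a \<eta> u :: real
  assumes \<eta>: "0 < \<eta>" "\<eta> < 1/2" and u: "u \<in> {0..1}"
  shows "((\<lambda>u. integral {\<eta>..1 - \<eta>} (\<lambda>y. beta_weight a y *\<^sub>R R (u * y))) has_vector_derivative
    integral {\<eta>..1 - \<eta>} (\<lambda>y. beta_weight a y *\<^sub>R (y *\<^sub>R (N * R (u * y) * R (u * y)))))
    (at u within {0..1})"
proof -
  let ?f' = "\<lambda>u y. beta_weight a y *\<^sub>R (y *\<^sub>R (N * R (u * y) * R (u * y)))"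
  have uy: "u * y \<in> {0..1}" if "u \<in> {0..1}" "y \<in> {\<eta>..1 - \<eta>}" for u y
    using \<eta> that by (auto intro: mult_le_one)
  have deriv: "((\<lambda>u. beta_weight a y *\<^sub>R R (u * y)) has_vector_derivative ?f' u y) (at u within {0..1})"
    if "u \<in> {0..1}" "y \<in> cbox \<eta> (1 - \<eta>)" for u y
  proof -
    have y: "y \<in> {\<eta>..1 - \<eta>}" using that by simp
    have "((\<lambda>u. u * y) has_vector_derivative y) (at u within {0..1})"
      by (auto intro!: derivative_eq_intros)
    moreover have "(R has_vector_derivative N * R (u * y) * R (u * y))
        (at (u * y) within ((\<lambda>u. u * y) ` {0..1}))"
      by (rule has_vector_derivative_within_subset[OF R_has_vector_derivative[OF uy[OF that(1) y]]])
        (use uy[OF _ y] in blast)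
    ultimately have "((\<lambda>u. R (u * y)) has_vector_derivative y *\<^sub>R (N * R (u * y) * R (u * y)))
        (at u within {0..1})"
      by (rule vector_diff_chain_within[unfolded o_def])
    then show ?thesis
      by (rule has_vector_derivative_scaleR[OF DERIV_const, simplified])
  qed
  have contR: "continuous_on S (\<lambda>p. R (h p))" if "continuous_on S h" "h ` S \<subseteq> {0..1}"
    for h :: "'z::topological_space \<Rightarrow> real" and S
    by (rule continuous_on_compose2[OF continuous_on_R that])
  have "((\<lambda>u. integral (cbox \<eta> (1 - \<eta>)) (\<lambda>y. beta_weight a y *\<^sub>R R (u * y))) has_vector_derivative
      integral (cbox \<eta> (1 - \<eta>)) (?f' u)) (at u within {0..1})"
  proof (rule leibniz_rule_vector_derivative[OF deriv])
    show "(\<lambda>y. beta_weight a y *\<^sub>R R (v * y)) integrable_on cbox \<eta> (1 - \<eta>)" if "v \<in> {0..1}" for v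
      unfolding interval_cbox[symmetric]
      by (intro integrable_continuous_real continuous_on_scaleR continuous_on_beta_weight contR
          continuous_intros \<eta>) (use uy[OF that] in blast)
    have "continuous_on ({0..1} \<times> {\<eta>..1 - \<eta>}) (\<lambda>p. R (fst p * snd p))"
      by (intro contR continuous_intros) (use uy in auto)
    moreover have "continuous_on ({0..1} \<times> {\<eta>..1 - \<eta>}) (\<lambda>p::real \<times> real. beta_weight a (snd p))"
      by (rule continuous_on_compose2[OF continuous_on_beta_weight[OF \<eta>(1)]])
        (auto intro!: continuous_intros)
    ultimately show "continuous_on ({0..1} \<times> cbox \<eta> (1 - \<eta>)) (\<lambda>(u, y). ?f' u y)"
      unfolding interval_cbox[symmetric] case_prod_beta by (intro continuous_intros)
  qed (use u in auto)
  then show ?thesis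
    by simp
qed

lemma exp_neg_log_bounded:
  obtains E where "E > 0" and "\<And>u. u \<in> {0..1} \<Longrightarrow> norm (exp (a *\<^sub>R neg_log u)) \<le> E"
proof -
  have "continuous_on {0..1} (\<lambda>u. exp (a *\<^sub>R neg_log u))"
    unfolding continuous_on_eq_continuous_within
    using exp_neg_log_has_vector_derivative has_vector_derivative_continuous by blast
  then have "bounded ((\<lambda>u. exp (a *\<^sub>R neg_log u)) ` {0..1})"
    by (intro compact_imp_bounded compact_continuous_image) simp_all
  then show thesis
    using that by (auto simp: bounded_pos)
qed

text \<open>Euler's integral representation of \<open>(1 - N) powr (- a)\<close>. The truncated Beta integral \<open>J u\<close> of
  \<open>R (u * y)\<close> and \<open>exp (a *\<^sub>R neg_log u)\<close> solve the same differential equation up to boundary terms,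
  so \<open>exp (- a *\<^sub>R neg_log u) * J u\<close> is nearly constant on \<open>{0..1}\<close>. At \<open>u = 0\<close> it equals the truncated
  mass of the density.\<close>

lemma beta_mean_exp_neg_log:
  assumes a: "0 < a" "a < 1"
  shows "beta_mean a R (exp (a *\<^sub>R neg_log 1))"
  unfolding beta_mean_def
proof
  show "continuous_on {0..1} R" by (rule continuous_on_R)
  let ?P = "exp (a *\<^sub>R neg_log 1)"
  obtain K where K: "K > 0" "\<And>u. u \<in> {0..1} \<Longrightarrow> norm (R u) \<le> K"
    using R_bounded by blast
  obtain E where E: "E > 0" "\<And>u. u \<in> {0..1} \<Longrightarrow> norm (exp ((- a) *\<^sub>R neg_log u)) \<le> E"
    using exp_neg_log_bounded[of "- a"] by blast
  define C where "C = norm ?P * (E * K * norm N * K)"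
  show "((\<lambda>\<eta>. integral {\<eta>..1 - \<eta>} (\<lambda>y. beta_weight a y *\<^sub>R R y)
        - integral {\<eta>..1 - \<eta>} (beta_weight a) *\<^sub>R ?P) \<longlongrightarrow> 0) (at_right 0)"
  proof (rule Lim_null_comparison)
    show "((\<lambda>\<eta>. C * (beta_boundary a \<eta> + beta_boundary a (1 - \<eta>))) \<longlongrightarrow> 0) (at_right 0)"
      by (rule tendsto_mult_right_zero[OF beta_boundary_tendsto_0[OF a]])
    have half: "0 < (1/2 :: real)" by simp
    show "\<forall>\<^sub>F \<eta> in at_right 0. norm (integral {\<eta>..1 - \<eta>} (\<lambda>y. beta_weight a y *\<^sub>R R y)
        - integral {\<eta>..1 - \<eta>} (beta_weight a) *\<^sub>R ?P)
        \<le> C * (beta_boundary a \<eta> + beta_boundary a (1 - \<eta>))"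
      using eventually_at_right_0_less[OF half]
    proof eventually_elim
      case \<eta>: (elim \<eta>)
      define J where "J u = integral {\<eta>..1 - \<eta>} (\<lambda>y. beta_weight a y *\<^sub>R R (u * y))" for u
      define J' where "J' u = integral {\<eta>..1 - \<eta>}
        (\<lambda>y. beta_weight a y *\<^sub>R (y *\<^sub>R (N * R (u * y) * R (u * y))))" for u
      define D where "D u = beta_boundary a (1 - \<eta>) *\<^sub>R R (u * (1 - \<eta>))
        - beta_boundary a \<eta> *\<^sub>R R (u * \<eta>)" for u
      define g where "g = beta_boundary a \<eta> + beta_boundary a (1 - \<eta>)"
      define Q where "Q u = exp ((- a) *\<^sub>R neg_log u)" for u
      define F where "F u = Q u * J u" for u
      have F': "(F has_vector_derivative - (Q u * R u * N * D u)) (at u within {0..1})"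
        if u: "u \<in> {0..1}" for u
      proof -
        have "(J has_vector_derivative J' u) (at u within {0..1})"
          unfolding J_def[abs_def] J'_def using \<eta> u by (intro beta_integral_has_vector_derivative) auto
        from has_vector_derivative_mult[OF exp_neg_log_has_vector_derivative[OF u, of "- a"] this]
        have "(F has_vector_derivative Q u * J' u - Q u * (a *\<^sub>R (N * R u)) * J u) (at u within {0..1})"
          by (simp add: F_def[abs_def] Q_def)
        moreover have "Q u * J' u = Q u * R u * ((1 - u *\<^sub>R N) * J' u)"
          by (metis R_left[OF u] mult.assoc mult_1)
        moreover have "(1 - u *\<^sub>R N) * J' u = a *\<^sub>R (N * J u) - N * D u"
          unfolding J_def J'_def D_def using \<eta> u by (intro beta_integration_by_parts) auto
        ultimately have "(F has_vector_derivative Q u * R u * (a *\<^sub>R (N * J u) - N * D u)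
            - Q u * (a *\<^sub>R (R u * N)) * J u) (at u within {0..1})"
          by (simp only: R_N_commute[OF u])
        then show ?thesis
          by (simp add: algebra_simps)
      qed
      have bound: "norm (Q u * R u * N * D u) \<le> E * K * norm N * (K * g)" if u: "u \<in> {0..1}" for u
      proof -
        have D: "norm (D u) \<le> K * g"
        proof -
          have "norm (D u) \<le> beta_boundary a (1 - \<eta>) * norm (R (u * (1 - \<eta>)))
              + beta_boundary a \<eta> * norm (R (u * \<eta>))"
            unfolding D_def by (rule order_trans[OF norm_triangle_ineq4]) (simp add: beta_boundary_def)
          also have "\<dots> \<le> beta_boundary a (1 - \<eta>) * K + beta_boundary a \<eta> * K"
            using u \<eta> by (intro add_mono mult_left_mono K) (auto simp: beta_boundary_def intro: mult_le_one)
          finally show ?thesis by (simp add: g_def algebra_simps)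
        qed
        have "norm (Q u * R u * N * D u) \<le> norm (Q u) * norm (R u) * norm N * norm (D u)"
          by (intro order_trans[OF norm_mult_ineq] mult_right_mono) auto
        also have "\<dots> \<le> E * K * norm N * (K * g)"
          using E(2)[OF u] K(2)[OF u] D E(1) K(1) by (intro mult_mono) (auto simp: Q_def)
        finally show ?thesis .
      qed
      have "norm (F 1 - F 0) \<le> E * K * norm N * (K * g) * norm (1 - 0 :: real)"
      proof (rule differentiable_bound[of "{0..1}"])
        show "(F has_derivative (\<lambda>h. h *\<^sub>R - (Q u * R u * N * D u))) (at u within {0..1})"
          if "u \<in> {0..1}" for u
          using F'[OF that] by (simp add: has_vector_derivative_def)
        show "onorm (\<lambda>h. h *\<^sub>R - (Q u * R u * N * D u)) \<le> E * K * norm N * (K * g)"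
          if "u \<in> {0..1}" for u
          using bound[OF that] by (intro onorm_le) (simp add: mult.commute mult_left_mono)
      qed auto
      then have diff: "norm (F 1 - F 0) \<le> E * K * norm N * K * g"
        by (simp add: mult_ac)
      have "?P * Q 1 = 1"
        using exp_minus_inverse[of "a *\<^sub>R neg_log 1"] by (simp add: Q_def)
      then have "?P * F 1 = J 1"
        by (simp add: F_def flip: mult.assoc)
      moreover have "F 0 = integral {\<eta>..1 - \<eta>} (beta_weight a) *\<^sub>R 1"
      proof -
        have "integral {\<eta>..1 - \<eta>} ((\<lambda>r. r *\<^sub>R (1::'b)) \<circ> beta_weight a)
            = integral {\<eta>..1 - \<eta>} (beta_weight a) *\<^sub>R 1"
          using \<eta> by (intro integral_linear integrable_continuous_real continuous_on_beta_weight
              bounded_linear_scaleR_left) auto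
        then show ?thesis
          by (simp add: F_def Q_def J_def R_0 neg_log_def o_def)
      qed
      ultimately have "J 1 - integral {\<eta>..1 - \<eta>} (beta_weight a) *\<^sub>R ?P = ?P * (F 1 - F 0)"
        by (simp add: right_diff_distrib)
      then have "norm (J 1 - integral {\<eta>..1 - \<eta>} (beta_weight a) *\<^sub>R ?P) \<le> norm ?P * norm (F 1 - F 0)"
        by (simp add: norm_mult_ineq)
      also have "\<dots> \<le> norm ?P * (E * K * norm N * K * g)"
        by (intro mult_left_mono diff) simp
      finally show ?case
        by (simp add: J_def C_def g_def mult.assoc)
    qed
  qed
qed

end

section \<open>Fractional powers of nonnegative elements\<close>

text \<open>The scalar case of Euler's integral, which supplies the comparison functions for norm estimates.\<close>

lemma beta_mean_real:
  assumes e: "0 < (e::real)" and a: "0 < a" "a < 1"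
  shows "beta_mean a (\<lambda>u. 1 / (1 - u + u * e)) (e powr (- a))"
proof -
  have pos: "0 < 1 - u + u * e" if "u \<in> {0..1}" for u
    using that e by (cases "u = 0") (auto intro: add_nonneg_pos)
  interpret invertible_segment "1 - e" "\<lambda>u. 1 / (1 - u + u * e)"
  proof
    fix u :: real assume "u \<in> {0..1}"
    from pos[OF this] show "1 / (1 - u + u * e) * (1 - u *\<^sub>R (1 - e)) = 1"
        "(1 - u *\<^sub>R (1 - e)) * (1 / (1 - u + u * e)) = 1"
      by (simp_all add: algebra_simps)
  qed
  have "exp (- neg_log 1) = e"
    using exp_minus_neg_log by simp
  then have "neg_log 1 = - ln e"
    by (metis ln_exp minus_minus)
  then show ?thesis
    using beta_mean_exp_neg_log[OF a] e by (simp add: powr_def)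
qed

text \<open>Here \<open>Q s\<close> is the inverse of \<open>s + T\<close>. The hypothesis \<open>1 \<le> M\<close> also covers the endpoint
  \<open>u = 0\<close> of the segment from \<open>1\<close> to \<open>e + T\<close>, where the inverse is \<open>1\<close>.\<close>

locale nonnegative_element =
  fixes T :: "'b::{real_normed_algebra_1,banach}" and Q :: "real \<Rightarrow> 'b" and M :: real
  assumes Q_left: "s > 0 \<Longrightarrow> Q s * (s *\<^sub>R 1 + T) = 1"
    and Q_right: "s > 0 \<Longrightarrow> (s *\<^sub>R 1 + T) * Q s = 1"
    and norm_Q: "s > 0 \<Longrightarrow> norm (Q s) \<le> M / s"
    and M_ge_1: "1 \<le> M"
begin

text \<open>The inverse of \<open>(1 - u) + u (e + T)\<close>. For \<open>u \<noteq> 0\<close> this element is \<open>u\<close> times a shift of \<open>T\<close>, which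
  is also why the norm bound below is \<open>M\<close> times the scalar \<open>1 / ((1 - u) + u e)\<close>.\<close>

definition R :: "real \<Rightarrow> real \<Rightarrow> 'b" where
  "R e u = (if u = 0 then 1 else (1 / u) *\<^sub>R Q ((1 - u + u * e) / u))"

lemma segment_pos:
  assumes "0 < e" "u \<in> {0..1}"
  shows "0 < 1 - u + u * (e::real)"
  using assms by (cases "u = 0") (auto intro: add_nonneg_pos)

lemma segment_eq:
  assumes "u \<noteq> 0"
  shows "1 - u *\<^sub>R (1 - (e *\<^sub>R 1 + T)) = u *\<^sub>R (((1 - u + u * e) / u) *\<^sub>R 1 + T)"
  using assms by (simp add: scaleR_add_right) (simp add: algebra_simps)

lemma invertible_segment: "0 < e \<Longrightarrow> invertible_segment (1 - (e *\<^sub>R 1 + T)) (R e)"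
proof
  fix u :: real assume e: "0 < e" and u: "u \<in> {0..1}"
  have "0 < (1 - u + u * e) / u" if "u \<noteq> 0"
    using segment_pos[OF e u] that u by simp
  then show "R e u * (1 - u *\<^sub>R (1 - (e *\<^sub>R 1 + T))) = 1"
      "(1 - u *\<^sub>R (1 - (e *\<^sub>R 1 + T))) * R e u = 1"
    by (cases "u = 0"; simp add: R_def segment_eq Q_left Q_right)+
qed

lemma norm_R:
  assumes e: "0 < e" and u: "u \<in> {0..1}"
  shows "norm (R e u) \<le> M * (1 / (1 - u + u * e))"
proof (cases "u = 0")
  case True
  then show ?thesis using M_ge_1 by (simp add: R_def)
next
  case False
  then have "norm (Q ((1 - u + u * e) / u)) \<le> M / ((1 - u + u * e) / u)"
    using segment_pos[OF e u] u by (intro norm_Q) simp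
  then show ?thesis
    using False u segment_pos[OF e u] by (simp add: R_def field_simps)
qed

definition log_shift :: "real \<Rightarrow> 'b" where
  "log_shift e = - invertible_segment.neg_log (1 - (e *\<^sub>R 1 + T)) (R e) 1"

definition powr_shift :: "real \<Rightarrow> real \<Rightarrow> 'b" where
  "powr_shift e t = exp (t *\<^sub>R log_shift e)"

lemma powr_shift_add: "powr_shift e (s + t) = powr_shift e s * powr_shift e t"
  unfolding powr_shift_def scaleR_add_left by (rule exp_add_commuting) simp

lemma powr_shift_1: "0 < e \<Longrightarrow> powr_shift e 1 = e *\<^sub>R 1 + T"
  using invertible_segment.exp_minus_neg_log[OF invertible_segment]
  by (simp add: powr_shift_def log_shift_def)

lemma powr_shift_of_nat_mult: "powr_shift e (real n * t) = powr_shift e t ^ n"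
  by (induction n) (simp_all add: distrib_right powr_shift_add, simp add: powr_shift_def)

lemma continuous_on_powr_shift: "continuous_on S (powr_shift e)"
  unfolding powr_shift_def[abs_def] continuous_on_eq_continuous_within
  using exp_scaleR_has_vector_derivative_right has_vector_derivative_continuous by blast

text \<open>Euler's integral represents negative powers only. The exponent \<open>t\<close> between \<open>0\<close> and \<open>1\<close> is
  reached by multiplying the power \<open>t - 1\<close> by \<open>e + T\<close>.\<close>

lemma beta_mean_powr_shift:
  assumes e: "0 < e" and t: "0 < t" "t < 1"
  shows "beta_mean (1 - t) (\<lambda>u. (e *\<^sub>R 1 + T) * R e u) (powr_shift e t)"
proof -
  have "beta_mean (1 - t) (R e) (powr_shift e (t - 1))"
    using invertible_segment.beta_mean_exp_neg_log[OF invertible_segment[OF e], of "1 - t"] t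
    by (simp add: powr_shift_def log_shift_def algebra_simps)
  then have "beta_mean (1 - t) (\<lambda>u. (e *\<^sub>R 1 + T) * R e u) ((e *\<^sub>R 1 + T) * powr_shift e (t - 1))"
    by (rule beta_mean_bounded_linear) (rule bounded_linear_mult_right)
  moreover have "(e *\<^sub>R 1 + T) * powr_shift e (t - 1) = powr_shift e t"
    using powr_shift_add[of e 1 "t - 1"] by (simp add: powr_shift_1 e)
  ultimately show ?thesis by simp
qed

text \<open>The key estimate. By the resolvent identity, \<open>(e + T) R e u - (d + T) R d u\<close> equals
  \<open>(1 - u) (e - d) R d u R e u\<close>. The scalar counterpart \<open>e / (1 - u + u e) - d / (1 - u + u d)\<close> satisfies
  the same identity, so the former is bounded by \<open>M\<^sup>2\<close> times the latter, and taking Beta means turns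
  this into a bound by the difference of the scalar powers.\<close>

lemma norm_powr_shift_diff:
  assumes d: "0 < d" and de: "d \<le> e" and t: "0 < t" "t \<le> 1"
  shows "norm (powr_shift e t - powr_shift d t) \<le> M\<^sup>2 * (e powr t - d powr t)"
proof (cases "t = 1")
  case True
  have "1 \<le> M\<^sup>2"
    using M_ge_1 by (simp add: one_le_power)
  then have "1 * (e - d) \<le> M\<^sup>2 * (e - d)"
    using de by (intro mult_right_mono) auto
  moreover have "powr_shift e 1 - powr_shift d 1 = (e - d) *\<^sub>R 1"
    using d de by (simp add: powr_shift_1 scaleR_diff_left)
  ultimately show ?thesis
    using d de True by simp
next
  case False
  then have t1: "t < 1" using t by simp
  have e: "0 < e" using d de by simp
  let ?r = "\<lambda>e u. 1 / (1 - u + u * e)"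
  have real: "beta_mean (1 - t) (\<lambda>u. e * ?r e u) (e powr t)" if "0 < e" for e :: real
  proof -
    have "e * e powr (t - 1) = e powr t"
      using powr_add[of e 1 "t - 1"] that by simp
    then show ?thesis
      using beta_mean_bounded_linear[OF beta_mean_real[OF that, of "1 - t"] bounded_linear_mult_right[of e]]
        t t1 by simp
  qed
  show ?thesis
  proof (rule beta_mean_norm_le)
    show "beta_mean (1 - t) (\<lambda>u. (e *\<^sub>R 1 + T) * R e u - (d *\<^sub>R 1 + T) * R d u)
        (powr_shift e t - powr_shift d t)"
      by (intro beta_mean_diff beta_mean_powr_shift d e t t1)
    show "beta_mean (1 - t) (\<lambda>u. M\<^sup>2 * (e * ?r e u - d * ?r d u)) (M\<^sup>2 * (e powr t - d powr t))"
      by (rule beta_mean_bounded_linear[OF beta_mean_diff[OF real[OF e] real[OF d]]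
            bounded_linear_mult_right])
    fix u :: real assume u: "0 < u" "u < 1"
    then have u01: "u \<in> {0..1}" by simp
    interpret E: invertible_segment "1 - (e *\<^sub>R 1 + T)" "R e" by (rule invertible_segment[OF e])
    interpret D: invertible_segment "1 - (d *\<^sub>R 1 + T)" "R d" by (rule invertible_segment[OF d])
    have diff: "R d u - R e u = (u * (e - d)) *\<^sub>R (R d u * R e u)"
    proof -
      have "R d u - R e u = R d u * ((1 - u *\<^sub>R (1 - (e *\<^sub>R 1 + T))) * R e u)
          - (R d u * (1 - u *\<^sub>R (1 - (d *\<^sub>R 1 + T)))) * R e u"
        by (simp only: E.R_right[OF u01] D.R_left[OF u01]) simp
      then show ?thesis
        by (simp add: algebra_simps)
    qed
    have "u *\<^sub>R ((e *\<^sub>R 1 + T) * R e u) = 1 - (1 - u) *\<^sub>R R e u"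
      using E.R_right[OF u01] by (simp add: algebra_simps)
    moreover have "u *\<^sub>R ((d *\<^sub>R 1 + T) * R d u) = 1 - (1 - u) *\<^sub>R R d u"
      using D.R_right[OF u01] by (simp add: algebra_simps)
    ultimately have "u *\<^sub>R ((e *\<^sub>R 1 + T) * R e u - (d *\<^sub>R 1 + T) * R d u) = (1 - u) *\<^sub>R (R d u - R e u)"
      by (simp add: scaleR_diff_right)
    also have "\<dots> = u *\<^sub>R (((1 - u) * (e - d)) *\<^sub>R (R d u * R e u))"
      by (simp add: diff mult_ac)
    finally have "(e *\<^sub>R 1 + T) * R e u - (d *\<^sub>R 1 + T) * R d u = ((1 - u) * (e - d)) *\<^sub>R (R d u * R e u)"
      using u by (simp only: scaleR_cancel_left) simp
    then have "norm ((e *\<^sub>R 1 + T) * R e u - (d *\<^sub>R 1 + T) * R d u)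
        \<le> (1 - u) * (e - d) * (norm (R d u) * norm (R e u))"
      using u de by (simp add: mult_left_mono norm_mult_ineq)
    also have "\<dots> \<le> (1 - u) * (e - d) * ((M * ?r d u) * (M * ?r e u))"
      using u de M_ge_1 segment_pos[OF d u01]
      by (intro mult_left_mono mult_mono norm_R d e u01) (auto intro!: mult_nonneg_nonneg)
    also have "\<dots> = M\<^sup>2 * (e * ?r e u - d * ?r d u)"
      using segment_pos[OF d u01] segment_pos[OF e u01]
      by (simp add: divide_simps power2_eq_square) (simp add: algebra_simps)
    finally show "norm ((e *\<^sub>R 1 + T) * R e u - (d *\<^sub>R 1 + T) * R d u) \<le> M\<^sup>2 * (e * ?r e u - d * ?r d u)" .
  qed
qed

abbreviation shift_seq :: "nat \<Rightarrow> real \<Rightarrow> 'b" where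
  "shift_seq n \<equiv> powr_shift (inverse (real (Suc n)))"

lemma inverse_Suc_powr_tendsto_0:
  assumes "0 < t"
  shows "(\<lambda>n. inverse (real (Suc n)) powr t) \<longlonglongrightarrow> 0"
proof (rule tendsto_zero_powrI[OF LIMSEQ_inverse_real_of_nat tendsto_const])
qed (use assms in auto)

text \<open>For \<open>t \<le> 1\<close> the key estimate makes the sequence Cauchy; larger exponents follow by taking
  powers.\<close>

lemma convergent_shift_seq:
  assumes t: "0 < t"
  shows "convergent (\<lambda>n. shift_seq n t)"
proof -
  have conv: "convergent (\<lambda>n. shift_seq n t)" if t: "0 < t" "t \<le> 1" for t
  proof (rule Cauchy_convergent, rule metric_CauchyI)
    fix \<epsilon> :: real assume "0 < \<epsilon>"
    have "(\<lambda>n. M\<^sup>2 * inverse (real (Suc n)) powr t) \<longlonglongrightarrow> 0"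
      by (rule tendsto_mult_right_zero[OF inverse_Suc_powr_tendsto_0[OF t(1)]])
    then obtain n0 where n0: "\<And>n. n0 \<le> n \<Longrightarrow> M\<^sup>2 * inverse (real (Suc n)) powr t < \<epsilon>"
      using order_tendstoD(2)[of _ 0 sequentially \<epsilon>] \<open>0 < \<epsilon>\<close> unfolding eventually_sequentially by blast
    have le: "dist (shift_seq m t) (shift_seq n t) < \<epsilon>" if "n0 \<le> m" "m \<le> n" for m n
    proof -
      have "dist (shift_seq m t) (shift_seq n t)
          \<le> M\<^sup>2 * (inverse (real (Suc m)) powr t - inverse (real (Suc n)) powr t)"
        unfolding dist_norm using that t by (intro norm_powr_shift_diff) auto
      also have "\<dots> \<le> M\<^sup>2 * inverse (real (Suc m)) powr t"
        by (intro mult_left_mono) auto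
      also have "\<dots> < \<epsilon>" by (rule n0[OF that(1)])
      finally show ?thesis .
    qed
    have "dist (shift_seq m t) (shift_seq n t) < \<epsilon>" if "n0 \<le> m" "n0 \<le> n" for m n
      using le[of m n] le[of n m] that by (cases "m \<le> n") (auto simp: dist_commute)
    then show "\<exists>n0. \<forall>m\<ge>n0. \<forall>n\<ge>n0. dist (shift_seq m t) (shift_seq n t) < \<epsilon>"
      by blast
  qed
  obtain k :: nat where k: "t < real k"
    using reals_Archimedean2 by blast
  with t have "0 < t / real k" "t / real k \<le> 1"
    by auto
  from conv[OF this] obtain L where "(\<lambda>n. shift_seq n (t / real k)) \<longlonglongrightarrow> L"
    by (auto simp: convergent_def)
  then have "(\<lambda>n. shift_seq n (t / real k) ^ k) \<longlonglongrightarrow> L ^ k"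
    by (rule tendsto_power)
  moreover have "shift_seq n (t / real k) ^ k = shift_seq n t" for n
    using powr_shift_of_nat_mult[of "inverse (real (Suc n))" k "t / real k", symmetric] k t by simp
  ultimately show ?thesis
    by (auto simp: convergent_def)
qed

definition frac_power :: "real \<Rightarrow> 'b" where
  "frac_power t = lim (\<lambda>n. shift_seq n t)"

lemma shift_seq_tendsto: "0 < t \<Longrightarrow> (\<lambda>n. shift_seq n t) \<longlonglongrightarrow> frac_power t"
  unfolding frac_power_def using convergent_shift_seq by (simp add: convergent_LIMSEQ_iff)

lemma frac_power_add:
  assumes "0 < s" "0 < t"
  shows "frac_power (s + t) = frac_power s * frac_power t"
proof (rule LIMSEQ_unique)
  show "(\<lambda>n. shift_seq n (s + t)) \<longlonglongrightarrow> frac_power (s + t)"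
    using assms by (intro shift_seq_tendsto) simp
  show "(\<lambda>n. shift_seq n (s + t)) \<longlonglongrightarrow> frac_power s * frac_power t"
    unfolding powr_shift_add by (intro tendsto_mult shift_seq_tendsto assms)
qed

lemma frac_power_1: "frac_power 1 = T"
proof (rule LIMSEQ_unique)
  show "(\<lambda>n. shift_seq n 1) \<longlonglongrightarrow> frac_power 1"
    by (intro shift_seq_tendsto) simp
  have "(\<lambda>n. inverse (real (Suc n)) *\<^sub>R 1 + T) \<longlonglongrightarrow> 0 *\<^sub>R 1 + T"
    by (intro tendsto_intros LIMSEQ_inverse_real_of_nat)
  then show "(\<lambda>n. shift_seq n 1) \<longlonglongrightarrow> T"
    by (simp add: powr_shift_1)
qed

lemma norm_powr_shift_minus_frac_power:
  assumes e: "0 < e" and t: "0 < t" "t \<le> 1"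
  shows "norm (powr_shift e t - frac_power t) \<le> M\<^sup>2 * e powr t"
proof -
  have lim: "(\<lambda>n. norm (powr_shift e t - shift_seq n t)) \<longlonglongrightarrow> norm (powr_shift e t - frac_power t)"
    by (intro tendsto_intros shift_seq_tendsto t)
  have "\<forall>\<^sub>F n in sequentially. inverse (real (Suc n)) < e"
    using LIMSEQ_inverse_real_of_nat e by (rule order_tendstoD)
  then have "\<forall>\<^sub>F n in sequentially. norm (powr_shift e t - shift_seq n t) \<le> M\<^sup>2 * e powr t"
  proof eventually_elim
    case (elim n)
    have "norm (powr_shift e t - shift_seq n t) \<le> M\<^sup>2 * (e powr t - inverse (real (Suc n)) powr t)"
      using elim t by (intro norm_powr_shift_diff) auto
    also have "\<dots> \<le> M\<^sup>2 * e powr t"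
      by (intro mult_left_mono) auto
    finally show ?case .
  qed
  then show ?thesis
    by (rule tendsto_upperbound[OF lim]) simp
qed

lemma frac_power_bounded: "\<exists>K. \<forall>t. 0 < t \<and> t \<le> 1 \<longrightarrow> norm (frac_power t) \<le> K"
proof (intro exI allI impI)
  fix t :: real assume t: "0 < t \<and> t \<le> 1"
  have "norm (frac_power t) \<le> norm (powr_shift 1 t) + norm (powr_shift 1 t - frac_power t)"
    using norm_triangle_ineq4[of "powr_shift 1 t" "powr_shift 1 t - frac_power t"] by simp
  moreover have "norm (powr_shift 1 t - frac_power t) \<le> M\<^sup>2"
    using norm_powr_shift_minus_frac_power[of 1 t] t by simp
  moreover have "norm (powr_shift 1 t) \<le> exp (norm (log_shift 1))"
    unfolding powr_shift_def using t
    by (intro order_trans[OF norm_exp]) (simp add: mult_left_le_one_le)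
  ultimately show "norm (frac_power t) \<le> exp (norm (log_shift 1)) + M\<^sup>2"
    by linarith
qed

lemma continuous_on_frac_power:
  assumes \<tau>: "0 < \<tau>"
  shows "continuous_on {\<tau>..1} frac_power"
proof (rule uniform_limit_theorem)
  show "uniform_limit {\<tau>..1} shift_seq frac_power sequentially"
  proof (rule uniform_limitI)
    fix \<epsilon> :: real assume "0 < \<epsilon>"
    have "(\<lambda>n. M\<^sup>2 * inverse (real (Suc n)) powr \<tau>) \<longlonglongrightarrow> 0"
      by (rule tendsto_mult_right_zero[OF inverse_Suc_powr_tendsto_0[OF \<tau>]])
    then have "\<forall>\<^sub>F n in sequentially. M\<^sup>2 * inverse (real (Suc n)) powr \<tau> < \<epsilon>"
      using \<open>0 < \<epsilon>\<close> by (rule order_tendstoD)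
    then show "\<forall>\<^sub>F n in sequentially. \<forall>t\<in>{\<tau>..1}. dist (shift_seq n t) (frac_power t) < \<epsilon>"
    proof eventually_elim
      case (elim n)
      show ?case
      proof
        fix t assume t: "t \<in> {\<tau>..1}"
        have "dist (shift_seq n t) (frac_power t) \<le> M\<^sup>2 * inverse (real (Suc n)) powr t"
          unfolding dist_norm using t \<tau> by (intro norm_powr_shift_minus_frac_power) auto
        also have "\<dots> \<le> M\<^sup>2 * inverse (real (Suc n)) powr \<tau>"
          using t by (intro mult_left_mono powr_mono') (auto simp: inverse_le_1_iff)
        finally show "dist (shift_seq n t) (frac_power t) < \<epsilon>"
          using elim by simp
      qed
    qed
  qed
  show "\<forall>\<^sub>F n in sequentially. continuous_on {\<tau>..1} (shift_seq n)"
    by (simp add: continuous_on_powr_shift)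
qed simp

lemma frac_power_of_nat_mult: "0 < t \<Longrightarrow> frac_power (real (Suc n) * t) = frac_power t ^ Suc n"
proof (induction n)
  case (Suc n)
  have "real (Suc (Suc n)) * t = t + real (Suc n) * t"
    by (simp add: algebra_simps)
  then have "frac_power (real (Suc (Suc n)) * t) = frac_power (t + real (Suc n) * t)"
    by (rule arg_cong)
  also have "\<dots> = frac_power t * frac_power (real (Suc n) * t)"
    using Suc.prems by (intro frac_power_add) auto
  finally show ?case
    using Suc by simp
qed simp

text \<open>Continuity on \<open>{0<..1}\<close> spreads to every \<open>t > 0\<close> through \<open>frac_power t = frac_power (t / m) ^ m\<close>.\<close>

lemma isCont_frac_power:
  assumes t: "0 < t"
  shows "isCont frac_power t"
proof -
  obtain n :: nat where n: "t < real n"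
    using reals_Archimedean2 by blast
  define m where "m = real (Suc n)"
  have m: "0 < m" "t < m" using n by (simp_all add: m_def)
  define x where "x = t / m"
  have x: "0 < x" "x < 1"
    using t m by (simp_all add: x_def)
  have "continuous_on {x / 2..1} frac_power"
    using x by (intro continuous_on_frac_power) simp
  then have "isCont frac_power x"
    by (rule continuous_on_interior) (use x in simp)
  moreover have "isCont (\<lambda>s. s / m) t"
    using m by simp
  ultimately have "isCont (\<lambda>s. frac_power (s / m)) t"
    unfolding x_def by (rule isCont_o2[rotated])
  then have "isCont (\<lambda>s. frac_power (s / m) ^ Suc n) t"
    by (rule continuous_power)
  moreover have eq: "frac_power s = frac_power (s / m) ^ Suc n" if "s \<in> {0<..}" for s
    using frac_power_of_nat_mult[of "s / m" n] m that by (simp add: m_def del: power_Suc of_nat_Suc)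
  have "\<forall>\<^sub>F s in nhds t. frac_power s = frac_power (s / m) ^ Suc n"
    by (rule eventually_mono[OF eventually_nhds_in_open[of "{0<..}"] eq]) (use t in auto)
  ultimately show ?thesis
    by (simp only: isCont_cong)
qed

end

section \<open>Bounded operators as a Banach algebra\<close>

text \<open>The class of unital normed algebras requires \<open>norm 1 = 1\<close>, which fails for the operators on the
  zero space. The product of the operator algebra with \<open>\<real>\<close>, under the maximum norm, always has this
  property, and the projection to the operators is a continuous homomorphism.\<close>

context
  notes [[typedef_overloaded]]
begin

datatype (dead 'a::real_normed_vector) op_scalar =
  OpScalar (op_part: "'a \<Rightarrow>\<^sub>L 'a") (scalar_part: real)

end

lemma op_scalar_eqI: "op_part x = op_part y \<Longrightarrow> scalar_part x = scalar_part y \<Longrightarrow> x = y"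
  by (rule op_scalar.expand) simp

instantiation op_scalar :: (real_normed_vector) real_algebra_1
begin

definition "0 = OpScalar 0 0"
definition "1 = OpScalar id_blinfun 1"
definition "x + y = OpScalar (op_part x + op_part y) (scalar_part x + scalar_part y)"
definition "- x = OpScalar (- op_part x) (- scalar_part x)"
definition "x - y = OpScalar (op_part x - op_part y) (scalar_part x - scalar_part y)"
definition "x * y = OpScalar (op_part x o\<^sub>L op_part y) (scalar_part x * scalar_part y)"
definition "a *\<^sub>R x = OpScalar (a *\<^sub>R op_part x) (a * scalar_part x)"

lemmas op_scalar_defs = zero_op_scalar_def one_op_scalar_def plus_op_scalar_def
  uminus_op_scalar_def minus_op_scalar_def times_op_scalar_def scaleR_op_scalar_def

instance
  by standard
    (auto intro!: op_scalar.expand blinfun_eqI simp: op_scalar_defs blinfun.bilinear_simps algebra_simps)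

end

lemma op_scalar_simps [simp]:
  "op_part 0 = 0" "scalar_part 0 = 0"
  "op_part 1 = id_blinfun" "scalar_part 1 = 1"
  "op_part (x + y) = op_part x + op_part y" "scalar_part (x + y) = scalar_part x + scalar_part y"
  "op_part (- x) = - op_part x" "scalar_part (- x) = - scalar_part x"
  "op_part (x - y) = op_part x - op_part y" "scalar_part (x - y) = scalar_part x - scalar_part y"
  "op_part (x * y) = op_part x o\<^sub>L op_part y" "scalar_part (x * y) = scalar_part x * scalar_part y"
  "op_part (a *\<^sub>R x) = a *\<^sub>R op_part x" "scalar_part (a *\<^sub>R x) = a * scalar_part x"
  by (simp_all add: op_scalar_defs)

instantiation op_scalar :: (real_normed_vector) real_normed_algebra_1
begin

definition norm_op_scalar :: "'a op_scalar \<Rightarrow> real" where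
  "norm_op_scalar x = max (norm (op_part x)) \<bar>scalar_part x\<bar>"

definition dist_op_scalar :: "'a op_scalar \<Rightarrow> 'a op_scalar \<Rightarrow> real" where
  "dist_op_scalar x y = norm (x - y)"

definition sgn_op_scalar :: "'a op_scalar \<Rightarrow> 'a op_scalar" where
  "sgn_op_scalar x = x /\<^sub>R norm x"

definition uniformity_op_scalar :: "('a op_scalar \<times> 'a op_scalar) filter" where
  "uniformity_op_scalar = (INF e\<in>{0 <..}. principal {(x, y). dist x y < e})"

definition open_op_scalar :: "'a op_scalar set \<Rightarrow> bool" where
  "open_op_scalar U \<longleftrightarrow>
     (\<forall>x\<in>U. eventually (\<lambda>(x', y). x' = x \<longrightarrow> y \<in> U) uniformity)"

instance
proof
  fix x y :: "'a op_scalar" and a :: real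
  show "norm x = 0 \<longleftrightarrow> x = 0"
    by (auto simp: norm_op_scalar_def max_def intro!: op_scalar_eqI split: if_splits)
  show "norm (x + y) \<le> norm x + norm y"
    using norm_triangle_ineq[of "op_part x" "op_part y"]
    by (auto simp: norm_op_scalar_def)
  show "norm (a *\<^sub>R x) = \<bar>a\<bar> * norm x"
    by (auto simp: norm_op_scalar_def abs_mult max_def mult_le_cancel_left_pos
        dest: mult_left_le_imp_le intro: antisym mult_left_mono split: if_splits)
  show "norm (x * y) \<le> norm x * norm y"
    by (auto simp: norm_op_scalar_def abs_mult intro: mult_mono
        intro!: order_trans[OF norm_blinfun_compose[of "op_part x" "op_part y"]])
  show "norm (1 :: 'a op_scalar) = 1"
    by (simp add: norm_op_scalar_def norm_blinfun_id_le)
qed (rule dist_op_scalar_def sgn_op_scalar_def uniformity_op_scalar_def open_op_scalar_def)+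

end

lemma bounded_linear_op_part: "bounded_linear op_part"
  by (rule bounded_linear_intro[of _ 1]) (simp_all add: norm_op_scalar_def)

lemma bounded_linear_scalar_part: "bounded_linear scalar_part"
  by (rule bounded_linear_intro[of _ 1]) (simp_all add: norm_op_scalar_def)

instance op_scalar :: (banach) banach
proof
  fix X :: "nat \<Rightarrow> 'a op_scalar"
  assume X: "Cauchy X"
  obtain A where A: "(\<lambda>n. op_part (X n)) \<longlonglongrightarrow> A"
    using bounded_linear.Cauchy[OF bounded_linear_op_part X] by (auto simp: Cauchy_convergent_iff convergent_def)
  obtain r where r: "(\<lambda>n. scalar_part (X n)) \<longlonglongrightarrow> r"
    using bounded_linear.Cauchy[OF bounded_linear_scalar_part X] by (auto simp: Cauchy_convergent_iff convergent_def)
  have "(\<lambda>n. X n - OpScalar A r) \<longlonglongrightarrow> 0"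
  proof (rule Lim_null_comparison)
    show "(\<lambda>n. norm (op_part (X n) - A) + \<bar>scalar_part (X n) - r\<bar>) \<longlonglongrightarrow> 0"
      using A r by (auto intro!: tendsto_add_zero simp: tendsto_norm_zero_iff LIM_zero_iff tendsto_rabs_zero_iff)
  qed (simp add: norm_op_scalar_def)
  then show "convergent X"
    using LIM_zero_cancel convergent_def by blast
qed

section \<open>Groups and semigroups on a real Banach space\<close>

lemma op_part_exp_scaleR:
  fixes A :: "'a::banach op_scalar"
  shows "op_part (exp ((s + t) *\<^sub>R A)) = op_part (exp (s *\<^sub>R A)) o\<^sub>L op_part (exp (t *\<^sub>R A))"
  unfolding scaleR_add_left by (subst exp_add_commuting) simp_all

lemma op_part_exp_scaleR_has_vector_derivative:
  fixes A :: "'a::banach op_scalar"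
  shows "((\<lambda>t. op_part (exp (t *\<^sub>R A))) has_vector_derivative op_part (exp (t *\<^sub>R A)) o\<^sub>L op_part A) (at t)"
  using bounded_linear.has_vector_derivative[OF bounded_linear_op_part
      exp_scaleR_has_vector_derivative_right[of A t UNIV]] by simp

text \<open>With scalar part \<open>1\<close> adjoined, the segment from the unit to \<open>T\<close> is invertible in the product
  algebra, and its logarithm generates the group.\<close>

lemma operator_log_group:
  fixes T :: "'a::banach \<Rightarrow>\<^sub>L 'a"
  assumes inv: "\<forall>s\<ge>0.
    \<exists>Q. Q o\<^sub>L (s *\<^sub>R id_blinfun + T) = id_blinfun \<and> (s *\<^sub>R id_blinfun + T) o\<^sub>L Q = id_blinfun"
  shows "\<exists>U A. (\<forall>s t. U (s + t) = U s o\<^sub>L U t) \<and> U 0 = id_blinfun \<and> U 1 = T \<and>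
    (\<forall>t. (U has_vector_derivative U t o\<^sub>L A) (at t))"
proof -
  obtain Q where Q: "\<And>s. 0 \<le> s \<Longrightarrow> Q s o\<^sub>L (s *\<^sub>R id_blinfun + T) = id_blinfun"
      "\<And>s. 0 \<le> s \<Longrightarrow> (s *\<^sub>R id_blinfun + T) o\<^sub>L Q s = id_blinfun"
    using inv by metis
  define R where "R u = OpScalar (if u = 0 then id_blinfun else (1 / u) *\<^sub>R Q ((1 - u) / u)) 1" for u :: real
  define N where "N = 1 - OpScalar T 1"
  have segment: "op_part (1 - u *\<^sub>R N) = u *\<^sub>R (((1 - u) / u) *\<^sub>R id_blinfun + T)" if "u \<noteq> 0" for u
    using that by (simp add: N_def scaleR_add_right) (simp add: algebra_simps)
  interpret invertible_segment N R
  proof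
    fix u :: real assume u: "u \<in> {0..1}"
    show "R u * (1 - u *\<^sub>R N) = 1"
    proof (rule op_scalar_eqI)
      show "op_part (R u * (1 - u *\<^sub>R N)) = op_part 1"
      proof (cases "u = 0")
        case False
        have "op_part (R u * (1 - u *\<^sub>R N)) = op_part (R u) o\<^sub>L op_part (1 - u *\<^sub>R N)"
          by (rule op_scalar_simps)
        also have "\<dots> = Q ((1 - u) / u) o\<^sub>L (((1 - u) / u) *\<^sub>R id_blinfun + T)"
          unfolding segment[OF False] using False
          by (simp add: R_def bounded_bilinear.scaleR_left[OF bounded_bilinear_blinfun_compose]
              bounded_bilinear.scaleR_right[OF bounded_bilinear_blinfun_compose])
        finally show ?thesis
          using Q(1)[of "(1 - u) / u"] u by simp
      qed (auto simp: R_def intro: blinfun_eqI)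
    qed (simp add: R_def N_def)
    show "(1 - u *\<^sub>R N) * R u = 1"
    proof (rule op_scalar_eqI)
      show "op_part ((1 - u *\<^sub>R N) * R u) = op_part 1"
      proof (cases "u = 0")
        case False
        have "op_part ((1 - u *\<^sub>R N) * R u) = op_part (1 - u *\<^sub>R N) o\<^sub>L op_part (R u)"
          by (rule op_scalar_simps)
        also have "\<dots> = (((1 - u) / u) *\<^sub>R id_blinfun + T) o\<^sub>L Q ((1 - u) / u)"
          unfolding segment[OF False] using False
          by (simp add: R_def bounded_bilinear.scaleR_left[OF bounded_bilinear_blinfun_compose]
              bounded_bilinear.scaleR_right[OF bounded_bilinear_blinfun_compose])
        finally show ?thesis
          using Q(2)[of "(1 - u) / u"] u by simp
      qed (auto simp: R_def intro: blinfun_eqI)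
    qed (simp add: R_def N_def)
  qed
  let ?U = "\<lambda>t. op_part (exp (t *\<^sub>R (- neg_log 1)))"
  have "?U 1 = T"
    using exp_minus_neg_log by (simp add: N_def)
  then show ?thesis
    using op_part_exp_scaleR_has_vector_derivative[of "- neg_log 1"] op_part_exp_scaleR[of _ _ "- neg_log 1"]
    by (intro exI[of _ ?U] exI[of _ "op_part (- neg_log 1)"] conjI allI) auto
qed

text \<open>Here \<open>T\<close> is paired with the scalar \<open>0\<close>: the second component of the resolvent is then \<open>1 / s\<close>,
  so the bounds of a nonnegative element hold with the constant \<open>max M 1\<close>.\<close>

lemma nonnegative_operator_powers:
  fixes T :: "'a::banach \<Rightarrow>\<^sub>L 'a"
  assumes inv: "\<forall>s>0. \<exists>Q. Q o\<^sub>L (s *\<^sub>R id_blinfun + T) = id_blinfun \<and>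
      (s *\<^sub>R id_blinfun + T) o\<^sub>L Q = id_blinfun \<and> norm Q \<le> M / s"
  shows "\<exists>P :: real \<Rightarrow> 'a \<Rightarrow>\<^sub>L 'a. (\<forall>s>0. \<forall>t>0. P (s + t) = P s o\<^sub>L P t) \<and> P 1 = T \<and> (\<forall>t>0. isCont P t) \<and>
    (\<exists>K. \<forall>t. 0 < t \<and> t \<le> 1 \<longrightarrow> norm (P t) \<le> K)"
proof -
  obtain Q where Q: "\<And>s. 0 < s \<Longrightarrow> Q s o\<^sub>L (s *\<^sub>R id_blinfun + T) = id_blinfun"
      "\<And>s. 0 < s \<Longrightarrow> (s *\<^sub>R id_blinfun + T) o\<^sub>L Q s = id_blinfun"
      "\<And>s. 0 < s \<Longrightarrow> norm (Q s) \<le> M / s"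
    using inv by metis
  define q where "q s = OpScalar (Q s) (1 / s)" for s
  interpret nonnegative_element "OpScalar T 0" q "max M 1"
  proof
    fix s :: real assume s: "0 < s"
    show "q s * (s *\<^sub>R 1 + OpScalar T 0) = 1" "(s *\<^sub>R 1 + OpScalar T 0) * q s = 1"
      using s by (auto intro!: op_scalar_eqI simp: q_def Q)
    have "norm (Q s) \<le> max M 1 / s"
      by (rule order_trans[OF Q(3)[OF s]]) (use s in \<open>simp add: divide_right_mono\<close>)
    then show "norm (q s) \<le> max M 1 / s"
      using s by (simp add: q_def norm_op_scalar_def divide_right_mono)
  qed simp
  obtain K where K: "\<And>t. 0 < t \<Longrightarrow> t \<le> 1 \<Longrightarrow> norm (frac_power t) \<le> K"
    using frac_power_bounded by blast
  show ?thesis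
  proof (intro exI[of _ "\<lambda>t. op_part (frac_power t)"] conjI allI impI)
    show "op_part (frac_power (s + t)) = op_part (frac_power s) o\<^sub>L op_part (frac_power t)"
      if "0 < s" "0 < t" for s t
      using that by (simp add: frac_power_add)
    show "op_part (frac_power 1) = T"
      by (simp add: frac_power_1)
    show "isCont (\<lambda>t. op_part (frac_power t)) t" if "0 < t" for t
      by (rule bounded_linear.isCont[OF bounded_linear_op_part isCont_frac_power[OF that]])
    have "norm (op_part (frac_power t)) \<le> K" if "0 < t" "t \<le> 1" for t
      using K[OF that] by (simp add: norm_op_scalar_def)
    then show "\<exists>K. \<forall>t. 0 < t \<and> t \<le> 1 \<longrightarrow> norm (op_part (frac_power t)) \<le> K"
      by blast
  qed
qed

text \<open>The powers are continuous in norm away from \<open>0\<close>, so only strong continuity at \<open>0\<close> is at stake.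
  On the range of \<open>T\<close> it holds because \<open>P t (T y) = P (t + 1) y\<close>. The uniform bound on \<open>P t\<close> for
  \<open>t \<le> 1\<close> extends it to the closure of the range.\<close>

lemma nonnegative_operator_semigroup:
  fixes T :: "'a::banach \<Rightarrow>\<^sub>L 'a"
  assumes inv: "\<forall>s>0. \<exists>Q. Q o\<^sub>L (s *\<^sub>R id_blinfun + T) = id_blinfun \<and>
      (s *\<^sub>R id_blinfun + T) o\<^sub>L Q = id_blinfun \<and> norm Q \<le> M / s"
    and dense: "closure (range (blinfun_apply T)) = UNIV"
  shows "\<exists>U :: real \<Rightarrow> 'a \<Rightarrow>\<^sub>L 'a. (\<forall>s\<ge>0. \<forall>t\<ge>0. U (s + t) = U s o\<^sub>L U t) \<and> U 0 = id_blinfun \<and> U 1 = T \<and>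
    (\<forall>x. continuous_on {0..} (\<lambda>t. blinfun_apply (U t) x))"
proof -
  obtain P :: "real \<Rightarrow> 'a \<Rightarrow>\<^sub>L 'a" and K
    where "\<forall>s>0. \<forall>t>0. P (s + t) = P s o\<^sub>L P t" "P 1 = T" "\<forall>t>0. isCont P t"
      "\<forall>t. 0 < t \<and> t \<le> 1 \<longrightarrow> norm (P t) \<le> K"
    using nonnegative_operator_powers[OF inv] by (elim exE conjE) (rule that)
  then have P: "\<And>s t. 0 < s \<Longrightarrow> 0 < t \<Longrightarrow> P (s + t) = P s o\<^sub>L P t" "P 1 = T"
      "\<And>t. 0 < t \<Longrightarrow> isCont P t" "\<And>t. 0 < t \<Longrightarrow> t \<le> 1 \<Longrightarrow> norm (P t) \<le> K"
    by simp_all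
  have K: "0 \<le> K"
    using order_trans[OF norm_ge_zero P(4)[of 1]] by simp
  define U where "U t = (if t = 0 then id_blinfun else P t)" for t
  have U: "U t = P t" if "0 < t" for t
    using that by (simp add: U_def)
  have range: "((\<lambda>t. P t (T y)) \<longlongrightarrow> T y) (at_right 0)" for y
  proof -
    have "isCont (\<lambda>t. P (t + 1)) 0"
      by (rule isCont_o2[where f = "\<lambda>t. t + 1" and g = P]) (simp_all add: P(3))
    then have "isCont (\<lambda>t. P (t + 1) y) 0"
      by (intro blinfun.continuous continuous_const)
    then have "((\<lambda>t. P (t + 1) y) \<longlongrightarrow> T y) (at 0)"
      by (simp add: isCont_def P(2))
    then have "((\<lambda>t. P (t + 1) y) \<longlongrightarrow> T y) (at_right 0)"
      by (rule tendsto_within_subset) simp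
    moreover have "\<forall>\<^sub>F t in at_right 0. P (t + 1) y = P t (T y)"
      using eventually_at_right_less[of 0] by eventually_elim (simp add: P(1)[of _ 1] P(2))
    ultimately show ?thesis
      by (rule Lim_transform_eventually)
  qed
  have at_0: "((\<lambda>t. P t x) \<longlongrightarrow> x) (at_right 0)" for x
  proof (rule tendstoI)
    fix \<epsilon> :: real assume \<epsilon>: "0 < \<epsilon>"
    \<comment> \<open>Replacing \<open>x\<close> by a point of the range within \<open>d\<close> costs \<open>K * d\<close> under \<open>P t\<close> and \<open>d\<close> outside.\<close>
    define d where "d = \<epsilon> / (2 * (K + 1))"
    have d: "0 < d" "(K + 1) * d = \<epsilon> / 2"
      using K \<epsilon> by (simp_all add: d_def divide_simps)
    have "x \<in> closure (range (blinfun_apply T))"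
      using dense by simp
    then obtain y where y: "dist (T y) x < d"
      using d by (auto simp: closure_approachable)
    have "\<forall>\<^sub>F t in at_right 0. dist (P t (T y)) (T y) < \<epsilon> / 2"
      using range[of y] \<epsilon> by (intro tendstoD) simp_all
    moreover have "\<forall>\<^sub>F t in at_right (0::real). 0 < t \<and> t < 1"
      by (rule eventually_at_right_0_less) simp
    ultimately show "\<forall>\<^sub>F t in at_right 0. dist (P t x) x < \<epsilon>"
    proof eventually_elim
      case (elim t)
      have "dist (P t x) (P t (T y)) = norm (P t (x - T y))"
        by (simp add: dist_norm blinfun.diff_right)
      also have "\<dots> \<le> norm (P t) * norm (x - T y)"
        by (rule norm_blinfun)
      also have "\<dots> \<le> K * d"
        using P(4)[of t] elim y K by (intro mult_mono) (auto simp: dist_norm norm_minus_commute)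
      finally have "dist (P t x) (P t (T y)) \<le> K * d" .
      then have "dist (P t x) x < K * d + \<epsilon> / 2 + d"
        using elim(1) y dist_triangle[of "P t x" x "P t (T y)"] dist_triangle[of "P t (T y)" x "T y"]
        by linarith
      then show ?case
        using d(2) by (simp add: algebra_simps)
    qed
  qed
  show ?thesis
  proof (intro exI[of _ U] conjI allI impI)
    show "U (s + t) = U s o\<^sub>L U t" if "0 \<le> s" "0 \<le> t" for s t
      using that P(1)[of s t] by (auto simp: U_def intro: blinfun_eqI)
    show "U 0 = id_blinfun" "U 1 = T"
      by (simp_all add: U_def P)
    show "continuous_on {0..} (\<lambda>t. U t x)" for x
      unfolding continuous_on_def
    proof
      fix t :: real assume "t \<in> {0..}"
      then consider "t = 0" | "0 < t" by fastforce
      then show "((\<lambda>t. U t x) \<longlongrightarrow> U t x) (at t within {0..})"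
      proof cases
        case 1
        have "{0..} - {0::real} = {0<..} - {0}"
          by auto
        then have "at (0::real) within {0..} = at_right 0"
          by (simp only: at_within_def)
        moreover have "\<forall>\<^sub>F t in at_right 0. P t x = U t x"
          using eventually_at_right_less[of 0] by eventually_elim (simp add: U)
        ultimately show ?thesis
          using Lim_transform_eventually[OF at_0] 1 by (simp add: U_def)
      next
        case 2
        have "isCont (\<lambda>t. P t x) t"
          using P(3)[OF 2] by (intro blinfun.continuous continuous_const)
        then have "((\<lambda>t. P t x) \<longlongrightarrow> U t x) (at t)"
          by (simp add: isCont_def U 2)
        then have "((\<lambda>t. P t x) \<longlongrightarrow> U t x) (at t within {0..})"
          by (rule tendsto_within_subset) simp
        moreover have "\<forall>\<^sub>F t in at t within {0..}. P t x = U t x"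
          unfolding eventually_at_topological using 2 by (intro exI[of _ "{0<..}"]) (auto simp: U)
        ultimately show ?thesis
          by (rule Lim_transform_eventually)
      qed
    qed
  qed
qed

section \<open>Complexification of operators\<close>

lift_definition complexify :: "('a::real_normed_vector \<Rightarrow>\<^sub>L 'a) \<Rightarrow> 'a oper"
  is "\<lambda>A z. Cx (A (re_part z)) (A (im_part z))"
proof -
  fix A :: "'a \<Rightarrow> 'a" assume A: "bounded_linear A"
  interpret A: bounded_linear A by (rule A)
  show "bounded_linear (\<lambda>z. Cx (A (re_part z)) (A (im_part z)))"
  proof (rule bounded_linear_intro)
    fix z :: "'a complexification"
    have "norm (Cx (A (re_part z)) (A (im_part z))) \<le> norm (A (re_part z)) + norm (A (im_part z))"
      using norm_complexification_parts(3)[of "Cx (A (re_part z)) (A (im_part z))"] by simp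
    also have "\<dots> \<le> onorm A * norm z + onorm A * norm z"
      by (intro add_mono order_trans[OF onorm[OF A]] mult_left_mono norm_complexification_parts onorm_pos_le A)
    finally show "norm (Cx (A (re_part z)) (A (im_part z))) \<le> norm z * (2 * onorm A)"
      by (simp add: mult_ac)
  qed (auto intro!: complexification_eqI simp: A.add A.scaleR)
qed

lemma complexify_parts [simp]:
  "re_part (complexify A z) = A (re_part z)" "im_part (complexify A z) = A (im_part z)"
  by (simp_all add: complexify.rep_eq)

lemma oper_eqI:
  "(\<And>z. re_part (blinfun_apply S z) = re_part (blinfun_apply T z)) \<Longrightarrow>
    (\<And>z. im_part (blinfun_apply S z) = im_part (blinfun_apply T z)) \<Longrightarrow> S = T"
  by (intro blinfun_eqI complexification_eqI)

lemma complexify_id: "complexify id_blinfun = id_blinfun"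
  by (rule oper_eqI) simp_all

lemma complexify_compose: "complexify (A o\<^sub>L B) = complexify A o\<^sub>L complexify B"
  by (rule oper_eqI) simp_all

lemma complex_linear_complexify: "complex_linear (complexify A)"
  by (auto simp: complex_linear_def blinfun.bilinear_simps intro!: complexification_eqI)

lemma real_operator_complexify: "real_operator (complexify A)"
  by (auto simp: real_operator_def real_subspace_def complexify.rep_eq blinfun.zero_right)

lemma tendsto_complexificationI:
  assumes "((\<lambda>t. re_part (f t)) \<longlongrightarrow> re_part z) F" and "((\<lambda>t. im_part (f t)) \<longlongrightarrow> im_part z) F"
  shows "(f \<longlongrightarrow> z) F"
proof (rule LIM_zero_cancel, rule Lim_null_comparison)
  show "((\<lambda>t. norm (re_part (f t) - re_part z) + norm (im_part (f t) - im_part z)) \<longlongrightarrow> 0) F"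
    using assms by (auto intro!: tendsto_add_zero simp: tendsto_norm_zero_iff LIM_zero_iff)
  show "\<forall>\<^sub>F t in F. norm (f t - z) \<le> norm (re_part (f t) - re_part z) + norm (im_part (f t) - im_part z)"
    using norm_complexification_parts(3)[of "f _ - z"] by simp
qed

lemma continuous_on_complexify:
  assumes "\<And>x. continuous_on X (\<lambda>t. blinfun_apply (U t) x)"
  shows "continuous_on X (\<lambda>t. blinfun_apply (complexify (U t)) z)"
  using assms unfolding continuous_on_def by (auto intro!: tendsto_complexificationI)

text \<open>For a real operator this is the restriction to \<open>Y\<close>. It is defined for every operator because the
  resolvents to which it is applied are not yet known to be real.\<close>

lift_definition real_compression :: "'a::real_normed_vector oper \<Rightarrow> 'a \<Rightarrow>\<^sub>L 'a"
  is "\<lambda>S y. re_part (S (Cx y 0))"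
proof -
  fix S :: "'a complexification \<Rightarrow> 'a complexification" assume S: "bounded_linear S"
  have embed: "bounded_linear (\<lambda>y::'a. Cx y 0)"
  proof (rule bounded_linear_intro[of _ 1])
    show "norm (Cx y 0) \<le> norm y * 1" for y :: 'a
      using norm_complexification_parts(3)[of "Cx y 0"] by simp
  qed (auto intro: complexification_eqI)
  have "bounded_linear (re_part :: 'a complexification \<Rightarrow> 'a)"
    by (rule bounded_linear_intro[of _ 1]) (simp_all add: norm_complexification_parts)
  from bounded_linear_compose[OF this bounded_linear_compose[OF S embed]]
  show "bounded_linear (\<lambda>y. re_part (S (Cx y 0)))" .
qed

lemma norm_real_compression_le: "norm (real_compression S) \<le> norm S"
proof (rule norm_blinfun_bound)
  fix y :: 'a
  have "norm (Cx y 0) \<le> norm y"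
    using norm_complexification_parts(3)[of "Cx y 0"] by simp
  then have "norm (S (Cx y 0)) \<le> norm S * norm y"
    by (meson mult_left_mono norm_blinfun norm_ge_zero order_trans)
  then show "norm (real_compression S y) \<le> norm S * norm y"
    using norm_complexification_parts(1)[of "S (Cx y 0)"] by (simp add: real_compression.rep_eq)
qed simp

lemma complexify_real_compression:
  assumes linear: "complex_linear T" and real: "real_operator T"
  shows "complexify (real_compression T) = T"
proof -
  have T_Cx: "T (Cx y 0) = Cx (real_compression T y) 0" for y
  proof -
    have "T (Cx y 0) \<in> range (\<lambda>y. Cx y 0)"
      using real unfolding real_operator_def real_subspace_def by blast
    then show ?thesis
      by (auto simp: real_compression.rep_eq)
  qed
  have "T z = complexify (real_compression T) z" for z
  proof -
    have "z = Cx (re_part z) 0 + \<i> *\<^sub>C Cx (im_part z) 0"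
      by (rule complexification_eqI) simp_all
    then have "T z = T (Cx (re_part z) 0) + \<i> *\<^sub>C T (Cx (im_part z) 0)"
      using linear by (metis blinfun.add_right complex_linear_def)
    then show ?thesis
      by (auto simp: T_Cx intro!: complexification_eqI)
  qed
  then show ?thesis
    by (intro blinfun_eqI) simp
qed

text \<open>The real part of an inverse over the complexification already inverts the operator on the real
  space, since a real operator commutes with taking real parts. Hence the resolvents at real points
  transfer to the real space, and everything constructed from them there is automatically real.\<close>

lemma complexify_real_inverse:
  fixes s :: real
  assumes S: "inverse_op (scalar_op (complex_of_real (- s)) - complexify A) S"
  shows "(- real_compression S) o\<^sub>L (s *\<^sub>R id_blinfun + A) = id_blinfun"
    "(s *\<^sub>R id_blinfun + A) o\<^sub>L (- real_compression S) = id_blinfun"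
proof -
  let ?B = "s *\<^sub>R id_blinfun + A"
  have B: "scalar_op (complex_of_real (- s)) - complexify A = - complexify ?B"
    by (rule oper_eqI) (simp_all add: blinfun.bilinear_simps scalar_op.rep_eq)
  have left: "S (complexify ?B z) = - z" for z
  proof -
    have "S ((- complexify ?B) z) = z"
      using S unfolding inverse_op_def B by (metis blinfun_apply_blinfun_compose blinfun_apply_id_blinfun)
    then show ?thesis
      by (simp add: blinfun.bilinear_simps minus_equation_iff)
  qed
  have right: "complexify ?B (S z) = - z" for z
  proof -
    have "(- complexify ?B) (S z) = z"
      using S unfolding inverse_op_def B by (metis blinfun_apply_blinfun_compose blinfun_apply_id_blinfun)
    then show ?thesis
      by (simp add: blinfun.bilinear_simps minus_equation_iff)
  qed
  show "(- real_compression S) o\<^sub>L ?B = id_blinfun"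
  proof (rule blinfun_eqI)
    fix y
    have "complexify ?B (Cx y 0) = Cx (?B y) 0"
      by (simp add: complexify.rep_eq blinfun.zero_right)
    then show "((- real_compression S) o\<^sub>L ?B) y = id_blinfun y"
      using left[of "Cx y 0"] by (simp add: real_compression.rep_eq blinfun.minus_left)
  qed
  show "?B o\<^sub>L (- real_compression S) = id_blinfun"
  proof (rule blinfun_eqI)
    fix y
    have "?B (re_part (S (Cx y 0))) = - y"
      using arg_cong[OF right[of "Cx y 0"], of re_part] by simp
    then show "(?B o\<^sub>L (- real_compression S)) y = id_blinfun y"
      by (simp add: real_compression.rep_eq blinfun.minus_left blinfun.minus_right)
  qed
qed

lemma closure_range_complexify:
  assumes "closure (range (blinfun_apply (complexify A))) = UNIV"
  shows "closure (range (blinfun_apply A)) = UNIV"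
proof -
  have "y \<in> closure (range (blinfun_apply A))" for y
  proof -
    have "\<exists>x\<in>range (blinfun_apply A). dist x y < e" if "0 < e" for e
    proof -
      have "Cx y 0 \<in> closure (range (blinfun_apply (complexify A)))"
        using assms by simp
      then obtain z where z: "dist (complexify A z) (Cx y 0) < e"
        using \<open>0 < e\<close> by (auto simp: closure_approachable)
      have "dist (A (re_part z)) y \<le> dist (complexify A z) (Cx y 0)"
        using norm_complexification_parts(1)[of "complexify A z - Cx y 0"] by (simp add: dist_norm)
      with z have "dist (A (re_part z)) y < e" by simp
      then show ?thesis by blast
    qed
    then show ?thesis by (simp add: closure_approachable)
  qed
  then show ?thesis by auto
qed

section \<open>Embedding into real groups and semigroups\<close>

lemma bounded_group_generatorI:
  assumes "\<And>z. (diff_quot S z \<longlongrightarrow> blinfun_apply B z) (at 0)"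
  shows "bounded_group_generator S"
proof -
  have "group_generator S = blinfun_apply B"
    unfolding group_generator_def using assms by (intro ext tendsto_Lim) simp_all
  then show ?thesis
    using assms by (auto simp: bounded_group_generator_def group_generator_domain_def
        blinfun.bounded_linear_right)
qed

lemma group_embedding:
  fixes T :: "'y::banach oper"
  assumes linear: "complex_linear T" and real: "real_operator T"
    and spectrum: "spectrum T \<subseteq> UNIV - \<real>\<^sub>\<le>\<^sub>0"
  shows "\<exists>S. C0_group S \<and> bounded_group_generator S \<and> (\<forall>t. real_operator (S t)) \<and> S 1 = T"
proof -
  define T0 where "T0 = real_compression T"
  have T: "T = complexify T0"
    using complexify_real_compression[OF linear real] by (simp add: T0_def)
  have inv: "\<forall>s\<ge>0.
    \<exists>Q. Q o\<^sub>L (s *\<^sub>R id_blinfun + T0) = id_blinfun \<and> (s *\<^sub>R id_blinfun + T0) o\<^sub>L Q = id_blinfun"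
  proof (intro allI impI)
    fix s :: real assume "0 \<le> s"
    then have "complex_of_real (- s) \<notin> spectrum T"
      using spectrum by (auto simp: complex_nonpos_Reals_iff)
    then obtain S where "inverse_op (scalar_op (complex_of_real (- s)) - complexify T0) S"
      by (auto simp: spectrum_def T)
    from complexify_real_inverse[OF this]
    show "\<exists>Q. Q o\<^sub>L (s *\<^sub>R id_blinfun + T0) = id_blinfun \<and> (s *\<^sub>R id_blinfun + T0) o\<^sub>L Q = id_blinfun"
      by blast
  qed
  obtain U A where U: "\<forall>s t. U (s + t) = U s o\<^sub>L U t" "U 0 = id_blinfun" "U 1 = T0"
      "\<forall>t. (U has_vector_derivative U t o\<^sub>L A) (at t)"
    using operator_log_group[OF inv] by (elim exE conjE) (rule that)
  have cont: "continuous_on UNIV U"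
    using has_vector_derivative_continuous[OF U(4)[rule_format]] by (simp add: continuous_on_eq_continuous_within)
  have deriv: "((\<lambda>h. (U h x - x) /\<^sub>R h) \<longlongrightarrow> A x) (at 0)" for x
  proof -
    have "((\<lambda>t. U t x) has_vector_derivative (U 0 o\<^sub>L A) x) (at 0)"
      by (rule bounded_linear.has_vector_derivative[OF blinfun.bounded_linear_left U(4)[rule_format]])
    then have "((\<lambda>t. U t x) has_vector_derivative A x) (at 0)"
      by (simp add: U(2))
    then have "((\<lambda>h. norm (U h x - U 0 x - (h - 0) *\<^sub>R A x) / norm (h - 0)) \<longlongrightarrow> 0) (at 0)"
      by (simp add: has_vector_derivative_def has_derivative_iff_norm)
    then have "((\<lambda>h. norm ((U h x - x) /\<^sub>R h - A x)) \<longlongrightarrow> 0) (at 0)"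
    proof (rule Lim_transform_eventually)
      have "norm (U h x - U 0 x - (h - 0) *\<^sub>R A x) / norm (h - 0) = norm ((U h x - x) /\<^sub>R h - A x)"
        if "h \<noteq> 0" for h :: real
      proof -
        have "U h x - U 0 x - (h - 0) *\<^sub>R A x = h *\<^sub>R ((U h x - x) /\<^sub>R h - A x)"
          using that by (simp add: U(2) scaleR_diff_right)
        then show ?thesis using that by simp
      qed
      then show "\<forall>\<^sub>F h in at 0. norm (U h x - U 0 x - (h - 0) *\<^sub>R A x) / norm (h - 0)
          = norm ((U h x - x) /\<^sub>R h - A x)"
        by (auto simp: eventually_at_filter)
    qed
    then show ?thesis
      by (rule LIM_zero_cancel[OF tendsto_norm_zero_cancel])
  qed
  let ?S = "\<lambda>t. complexify (U t)"
  have "C0_group ?S"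
    unfolding C0_group_def
  proof (intro conjI allI)
    show "continuous_on UNIV (\<lambda>t. blinfun_apply (?S t) z)" for z
      by (intro continuous_on_complexify blinfun.continuous_on cont continuous_on_const)
  qed (simp_all only: complex_linear_complexify U complexify_id complexify_compose)
  moreover have "bounded_group_generator ?S"
  proof (rule bounded_group_generatorI)
    show "(diff_quot ?S z \<longlongrightarrow> complexify A z) (at 0)" for z
      unfolding diff_quot_def by (rule tendsto_complexificationI) (simp_all add: deriv)
  qed
  ultimately show ?thesis
    by (intro exI[of _ ?S]) (simp add: real_operator_complexify U(3) T)
qed

lemma semigroup_embedding:
  fixes T :: "'y::banach oper"
  assumes linear: "complex_linear T" and real: "real_operator T"
    and sectorial: "sectorial T" and dense: "closure (range (blinfun_apply T)) = UNIV"
  shows "real_embeddable T"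
proof -
  define T0 where "T0 = real_compression T"
  have T: "T = complexify T0"
    using complexify_real_compression[OF linear real] by (simp add: T0_def)
  from sectorial obtain \<delta> M where \<delta>: "\<delta> \<in> {0<..<pi}" "spectrum T \<subseteq> sector \<delta>"
    and "\<forall>l\<in>- sector \<delta>. norm (scalar_op l o\<^sub>L resolvent l T) \<le> M"
    unfolding sectorial_def bdd_above_def by auto
  then have M: "norm (scalar_op l o\<^sub>L resolvent l T) \<le> M" if "l \<notin> sector \<delta>" for l
    using that by simp
  have inv: "\<forall>s>0. \<exists>Q. Q o\<^sub>L (s *\<^sub>R id_blinfun + T0) = id_blinfun \<and>
      (s *\<^sub>R id_blinfun + T0) o\<^sub>L Q = id_blinfun \<and> norm Q \<le> M / s"
  proof (intro allI impI)
    fix s :: real assume s: "0 < s"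
    let ?l = "complex_of_real (- s)"
    have "Arg ?l = pi"
      using s by (simp add: Arg_eq_pi_iff del: of_real_minus) 
    then have l: "?l \<notin> sector \<delta>"
      using \<delta> s by (simp add: sector_def)
    then obtain S where S: "inverse_op (scalar_op ?l - T) S"
      using \<delta>(2) by (auto simp: spectrum_def)
    then have res: "resolvent ?l T = S"
      by (rule resolvent_eqI)
    have "norm S \<le> M / s"
    proof (rule norm_blinfun_bound)
      have "0 \<le> M"
        by (rule order_trans[OF norm_ge_zero M[OF l]])
      then show "0 \<le> M / s" using s by simp
      fix z
      have "scalar_op ?l (S z) = ?l *\<^sub>C S z"
        by (rule fun_cong[OF scalar_op.rep_eq])
      then have "norm ((scalar_op ?l o\<^sub>L S) z) = cmod ?l * norm (S z)"
        by (simp only: blinfun_apply_blinfun_compose norm_scaleC)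
      moreover have "cmod ?l = s"
        using s by (simp only: norm_of_real)
      ultimately have "s * norm (S z) \<le> norm (scalar_op ?l o\<^sub>L S) * norm z"
        using norm_blinfun[of "scalar_op ?l o\<^sub>L S" z] by (simp only:)
      also have "\<dots> \<le> M * norm z"
        by (rule mult_right_mono[OF M[OF l, unfolded res] norm_ge_zero])
      finally have "norm (S z) \<le> (M * norm z) / s"
        using s by (simp only: pos_le_divide_eq mult.commute)
      then show "norm (S z) \<le> M / s * norm z"
        by simp
    qed
    then have "norm (- real_compression S) \<le> M / s"
      using norm_real_compression_le[of S] by simp
    with complexify_real_inverse[OF S[unfolded T]]
    show "\<exists>Q. Q o\<^sub>L (s *\<^sub>R id_blinfun + T0) = id_blinfun \<and>
        (s *\<^sub>R id_blinfun + T0) o\<^sub>L Q = id_blinfun \<and> norm Q \<le> M / s"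
      by (intro exI[of _ "- real_compression S"] conjI)
  qed
  have dense0: "closure (range (blinfun_apply T0)) = UNIV"
    by (rule closure_range_complexify[OF dense[unfolded T]])
  obtain U :: "real \<Rightarrow> 'y \<Rightarrow>\<^sub>L 'y" where U: "\<forall>s\<ge>0. \<forall>t\<ge>0. U (s + t) = U s o\<^sub>L U t" "U 0 = id_blinfun" "U 1 = T0"
      "\<forall>x. continuous_on {0..} (\<lambda>t. blinfun_apply (U t) x)"
    using nonnegative_operator_semigroup[OF inv dense0] by (elim exE conjE) (rule that)
  let ?S = "\<lambda>t. complexify (U t)"
  have "C0_semigroup ?S"
    unfolding C0_semigroup_def
  proof (intro conjI allI impI)
    show "continuous_on {0..} (\<lambda>t. blinfun_apply (?S t) z)" for z
      by (rule continuous_on_complexify) (rule U(4)[rule_format])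
  qed (simp_all add: complex_linear_complexify U(1,2) complexify_id complexify_compose)
  then show ?thesis
    unfolding real_embeddable_def
  proof (intro conjI exI[of _ ?S] allI impI)
    show "complexify (U 1) = T"
      by (simp only: U(3) T)
  qed (simp_all only: real real_operator_complexify)
qed

theorem theorem2p5:
  shows "(\<forall>T :: 'y::banach complexification \<Rightarrow>\<^sub>L 'y complexification.
            complex_linear T \<and> real_operator T \<and> spectrum T \<subseteq> UNIV - \<real>\<^sub>\<le>\<^sub>0 \<longrightarrow>
            (\<exists>S :: real \<Rightarrow> 'y complexification \<Rightarrow>\<^sub>L 'y complexification.
               C0_group S \<and> bounded_group_generator S \<and> (\<forall>t. real_operator (S t)) \<and> S 1 = T))
       \<and> (\<forall>T :: 'y complexification \<Rightarrow>\<^sub>L 'y complexification.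
            complex_linear T \<and> real_operator T \<and> sectorial T \<and>
            closure (range (blinfun_apply T)) = UNIV \<longrightarrow>
            real_embeddable T)"
  using group_embedding semigroup_embedding by blast

end
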